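(* Assume there are constants $K_{\partial\Omega,\Omega},L_{\partial\Omega,\Omega},K_1,K_2$ such that for all $f\in C^1(\Omega)$ $$\mathrm{Var}_{\sigma_\beta}(f)\le K_{\partial\Omega,\Omega}\int_\Omega|\nabla f|^2\,d\lambda_\alpha,\qquad\mathrm{Ent}_{\sigma_\beta}(f^2)\le L_{\partial\Omega,\Omega}\int_\Omega|\nabla f|^2\,d\lambda_\alpha,$$ $$\left(\int_\Omega f\,d\lambda_\alpha-\int_{\partial\Omega}f\,d\sigma_\beta\right)^2\le K_1\int_\Omega|\nabla f|^2\,d\lambda_\alpha+K_2\int_{\partial\Omega}|\nabla^\tau f|^2\,d\sigma_\beta .$$ Then $$L_\mu\le\inf_{s,t\in[0,1]}\max\Big(L_{\lambda_\alpha}+s\,L_{\partial\Omega,\Omega}\frac BA+B\,\frac{\ln B-\ln A}{B-A}\left(C_{\lambda_\alpha}+t\,K_{\partial\Omega,\Omega}+K_1\right),\ (1-s)\,L_{\sigma_\beta}+A\,\frac{\ln B-\ln A}{B-A}\left((1-t)\,C_{\sigma_\beta}+K_2\right)\Big).$$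
   Context: Setting and notation. $\Omega$ is a smooth compact connected Riemannian manifold of dimension $d\ge2$ with smooth connected boundary $\partial\Omega$ (the boundary is included in $\Omega$). $\lambda$ is the volume measure on $\Omega$, $\sigma$ the Hausdorff (surface) measure on $\partial\Omega$, $\nabla$ the gradient on $\Omega$, $\nabla^\tau$ the tangential gradient on $\partial\Omega$. $C^1(\Omega)$ denotes functions that are $C^1$ up to the boundary; integrals over $\partial\Omega$ of functions on $\Omega$ use their restriction (trace). $\alpha,\beta:\Omega\to\mathbb{R}$ are weights, $A:=\int_\Omega\alpha\,d\lambda$, $B:=\int_{\partial\Omega}\beta\,d\sigma$, $d\lambda_\alpha:=\frac{\alpha}{A}d\lambda$, $d\sigma_\beta:=\frac{\beta}{B}d\sigma$, $d\mu:=\alpha\,d\lambda+\beta\,d\sigma$. For a probability measure $\nu$: $\mathrm{Var}_\nu(f)=\int f^2d\nu-(\int f\,d\nu)^2$ and $\mathrm{Ent}_\nu(f^2)=\int f^2\ln(f^2)d\nu-\int f^2d\nu\,\ln\int f^2d\nu$. Standing assumptions. (1) $\mu$ is a probability measure, with $A,B\in(0,1)$, $A+B=1$. (2) $\alpha,\beta\in C(\Omega)$, $\alpha>0$ $\lambda$-a.e. on $\Omega$, $\beta>0$ $\sigma$-a.e. on $\partial\Omega$, $\sqrt\alpha\in W^{1,2}(\Omega)$, $\sqrt\beta\in W^{1,2}(\partial\Omega)$. (3) The constants $C_{\lambda_\alpha},L_{\lambda_\alpha},C_{\sigma_\beta},L_{\sigma_\beta}$ are finite, where these are the smallest constants with $\mathrm{Var}_{\lambda_\alpha}(f)\le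 C_{\lambda_\alpha}\int_\Omega|\nabla f|^2d\lambda_\alpha$ and $\mathrm{Ent}_{\lambda_\alpha}(f^2)\le L_{\lambda_\alpha}\int_\Omega|\nabla f|^2d\lambda_\alpha$ for all $f\in C^1(\Omega)$, and $\mathrm{Var}_{\sigma_\beta}(f)\le C_{\sigma_\beta}\int_{\partial\Omega}|\nabla^\tau f|^2d\sigma_\beta$ and $\mathrm{Ent}_{\sigma_\beta}(f^2)\le L_{\sigma_\beta}\int_{\partial\Omega}|\nabla^\tau f|^2d\sigma_\beta$ for all $f\in C^1(\partial\Omega)$. (4) The following embeddings/traces hold: $W^{1,2}(\Omega,\alpha d\lambda)\to L^2(\Omega,\alpha d\lambda)$ compactly; $W^{1,2}(\Omega,\alpha d\lambda)\to L^p(\Omega,\beta d\lambda)$ for $p\in[2,\frac{2d-2}{d-2}]$; $W^{1,2}(\partial\Omega,\beta d\sigma)\to L^2(\partial\Omega,\beta d\sigma)$ compactly; the trace $W^{1,2}(\Omega,\alpha d\lambda)\to L^2(\partial\Omega,\beta d\sigma)$ compactly. $L_\mu$ is the smallest constant such that $\mathrm{Ent}_\mu(f^2)\le L_\mu\left(\int_\Omega|\nabla f|^2\alpha\,d\lambda+\int_{\partial\Omega}|\nabla^\tau f|^2\beta\,d\sigma\right)$ for all $f\in C^1(\Omega)$. If $A=B$, the quotient $\frac{\ln B-\ln A}{B-A}$ is read as its limit value $\frac1A=2$. *)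

theory Defs
  imports "HOL-Analysis.Analysis" "HOL-Probability.Probability_Measure"
begin

section \<open>Smoothness up to the boundary\<close>

primrec Ck_on :: "nat \<Rightarrow> 'a::real_normed_vector set \<Rightarrow> ('a \<Rightarrow> 'b::real_normed_vector) \<Rightarrow> bool" where
  "Ck_on 0 W F \<longleftrightarrow> continuous_on W F"
| "Ck_on (Suc k) W F \<longleftrightarrow> (\<forall>x\<in>W. F differentiable (at x)) \<and>
     (\<forall>v. Ck_on k W (\<lambda>x. frechet_derivative F (at x) v))"

text \<open>On a set that need not be open (such as a relatively open subset of a half-space), regularity
  means the existence of local extensions of that regularity to open sets.\<close>

definition C1_within :: "'a::real_normed_vector set \<Rightarrow> ('a \<Rightarrow> 'b::real_normed_vector) \<Rightarrow> bool" where
  "C1_within S f \<longleftrightarrow>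
     (\<forall>x\<in>S. \<exists>W F. open W \<and> x \<in> W \<and> Ck_on 1 W F \<and> (\<forall>y\<in>S \<inter> W. F y = f y))"

definition smooth_within :: "'a::real_normed_vector set \<Rightarrow> ('a \<Rightarrow> 'b::real_normed_vector) \<Rightarrow> bool" where
  "smooth_within S f \<longleftrightarrow>
     (\<forall>x\<in>S. \<exists>W F. open W \<and> x \<in> W \<and> (\<forall>k. Ck_on k W F) \<and> (\<forall>y\<in>S \<inter> W. F y = f y))"


section \<open>Riemannian manifolds with boundary\<close>

text \<open>A chart carries its domain, its coordinate map and the metric tensor expressed in it:
  \<open>cmet c p v w\<close> is the inner product at \<open>p\<close> of the tangent vectors whose coordinate
  representations in \<open>c\<close> are \<open>v\<close> and \<open>w\<close>. A manifold is given by an atlas of such charts.\<close>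

datatype ('a, 'e) rchart =
  RChart (cdom: "'a set") (cmap: "'a \<Rightarrow> 'e") (cmet: "'a \<Rightarrow> 'e \<Rightarrow> 'e \<Rightarrow> real")

definition crange :: "('a, 'e) rchart \<Rightarrow> 'e set" where
  "crange c = cmap c ` cdom c"

definition cinv :: "('a, 'e) rchart \<Rightarrow> 'e \<Rightarrow> 'a" where
  "cinv c = inv_into (cdom c) (cmap c)"

definition carrier :: "('a, 'e) rchart set \<Rightarrow> 'a set" where
  "carrier M = (\<Union>c\<in>M. cdom c)"

text \<open>\<open>H\<close> is the model region: a half-space for manifolds with boundary, the whole space
  for manifolds without boundary.\<close>

definition smooth_atlas ::
  "'e::euclidean_space set \<Rightarrow> ('a::t2_space, 'e) rchart set \<Rightarrow> bool" where
  "smooth_atlas H M \<longleftrightarrow>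
     (\<forall>c\<in>M. openin (top_of_set (carrier M)) (cdom c) \<and>
             openin (top_of_set H) (crange c) \<and>
             homeomorphism (cdom c) (crange c) (cmap c) (cinv c)) \<and>
     (\<forall>c\<in>M. \<forall>c'\<in>M. smooth_within (cmap c ` (cdom c \<inter> cdom c')) (cmap c' \<circ> cinv c))"

definition riemannian_metric :: "('a, 'e::euclidean_space) rchart set \<Rightarrow> bool" where
  "riemannian_metric M \<longleftrightarrow>
     (\<forall>c\<in>M. \<forall>p\<in>cdom c. bilinear (cmet c p) \<and> (\<forall>v w. cmet c p v w = cmet c p w v) \<and>
                          (\<forall>v. v \<noteq> 0 \<longrightarrow> cmet c p v v > 0)) \<and>
     (\<forall>c\<in>M. \<forall>v w. smooth_within (crange c) (\<lambda>x. cmet c (cinv c x) v w)) \<and>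
     (\<forall>c\<in>M. \<forall>c'\<in>M. \<forall>p\<in>cdom c \<inter> cdom c'.
        let D = frechet_derivative (cmap c' \<circ> cinv c)
                  (at (cmap c p) within cmap c ` (cdom c \<inter> cdom c'))
        in \<forall>v w. cmet c p v w = cmet c' p (D v) (D w))"

definition riemannian_manifold ::
  "'e::euclidean_space set \<Rightarrow> ('a::t2_space, 'e) rchart set \<Rightarrow> bool" where
  "riemannian_manifold H M \<longleftrightarrow> smooth_atlas H M \<and> riemannian_metric M"

definition half_space :: "(real \<times> 'b::euclidean_space) set" where
  "half_space = {z. 0 \<le> fst z}"

text \<open>The boundary as a Riemannian manifold modelled on \<open>'b\<close>, with the induced metric.\<close>

definition bchart :: "('a, real \<times> 'b::euclidean_space) rchart \<Rightarrow> ('a, 'b) rchart" where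
  "bchart c = RChart {p \<in> cdom c. fst (cmap c p) = 0} (\<lambda>p. snd (cmap c p))
                     (\<lambda>p v w. cmet c p (0, v) (0, w))"

definition bdry :: "('a, real \<times> 'b::euclidean_space) rchart set \<Rightarrow> ('a, 'b) rchart set" where
  "bdry M = bchart ` M"


section \<open>\<open>C\<^sup>1\<close> functions and gradients\<close>

text \<open>Functions on the manifold are functions on the ambient type; their values off the carrier
  are irrelevant, and restriction to the boundary is implicit.\<close>

definition C1 :: "('a, 'e::euclidean_space) rchart set \<Rightarrow> ('a \<Rightarrow> real) set" where
  "C1 M = {f. \<forall>c\<in>M. C1_within (crange c) (f \<circ> cinv c)}"

definition grad :: "('a, 'e::euclidean_space) rchart \<Rightarrow> ('a \<Rightarrow> real) \<Rightarrow> 'a \<Rightarrow> 'e" where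
  "grad c f p = (THE v. \<forall>w. cmet c p v w =
     frechet_derivative (f \<circ> cinv c) (at (cmap c p) within crange c) w)"

text \<open>The squared length of the gradient; it does not depend on the chart chosen.\<close>

definition grad_sq :: "('a, 'e::euclidean_space) rchart set \<Rightarrow> ('a \<Rightarrow> real) \<Rightarrow> 'a \<Rightarrow> real" where
  "grad_sq M f p = (let c = (SOME c. c \<in> M \<and> p \<in> cdom c); v = grad c f p in cmet c p v v)"


section \<open>Volume and surface measure\<close>

text \<open>Determinant of the Gram matrix of \<open>g\<close> in the standard basis (Leibniz formula).\<close>

definition gram_det :: "('e::euclidean_space \<Rightarrow> 'e \<Rightarrow> real) \<Rightarrow> real" where
  "gram_det g = (\<Sum>q | q permutes (Basis::'e set). of_int (sign q) * (\<Prod>b\<in>Basis. g b (q b)))"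

definition riemannian_volume ::
  "('a::topological_space, 'e::euclidean_space) rchart set \<Rightarrow> 'a measure \<Rightarrow> bool" where
  "riemannian_volume M \<nu> \<longleftrightarrow>
     sets \<nu> = sets (restrict_space borel (carrier M)) \<and>
     (\<forall>c\<in>M. \<forall>E\<in>sets \<nu>. E \<subseteq> cdom c \<longrightarrow>
        emeasure \<nu> E =
          (\<integral>\<^sup>+x. ennreal (sqrt (gram_det (cmet c (cinv c x)))) * indicator (cmap c ` E) x \<partial>lborel))"

definition C1_curve ::
  "('a::topological_space, 'e::euclidean_space) rchart set \<Rightarrow> (real \<Rightarrow> 'a) \<Rightarrow> bool" where
  "C1_curve M \<gamma> \<longleftrightarrow> path \<gamma> \<and> path_image \<gamma> \<subseteq> carrier M \<and>
     (\<forall>c\<in>M. C1_within {t\<in>{0..1}. \<gamma> t \<in> cdom c} (cmap c \<circ> \<gamma>))"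

definition speed ::
  "('a, 'e::euclidean_space) rchart set \<Rightarrow> (real \<Rightarrow> 'a) \<Rightarrow> real \<Rightarrow> real" where
  "speed M \<gamma> t = (let c = (SOME c. c \<in> M \<and> \<gamma> t \<in> cdom c);
                      v = vector_derivative (cmap c \<circ> \<gamma>) (at t within {0..1})
                  in sqrt (cmet c (\<gamma> t) v v))"

definition rdist ::
  "('a::topological_space, 'e::euclidean_space) rchart set \<Rightarrow> 'a \<Rightarrow> 'a \<Rightarrow> real" where
  "rdist M p q = (INF \<gamma>\<in>{\<gamma>. C1_curve M \<gamma> \<and> pathstart \<gamma> = p \<and> pathfinish \<gamma> = q}.
                    integral {0..1} (speed M \<gamma>))"

definition rdiam ::
  "('a::topological_space, 'e::euclidean_space) rchart set \<Rightarrow> 'a set \<Rightarrow> ennreal" where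
  "rdiam M S = (SUP p\<in>S. SUP q\<in>S. ennreal (rdist M p q))"

text \<open>The \<open>k\<close>-dimensional Hausdorff measure, \<open>k > 0\<close>, with respect to the Riemannian distance,
  normalised so that it agrees with \<open>k\<close>-dimensional volume.\<close>

definition hausdorff_pre ::
  "('a::topological_space, 'e::euclidean_space) rchart set \<Rightarrow> nat \<Rightarrow> ennreal \<Rightarrow> 'a set \<Rightarrow> ennreal" where
  "hausdorff_pre M k \<delta> E =
     (INF C\<in>{C::nat \<Rightarrow> 'a set. E \<subseteq> (\<Union>n. C n) \<and> (\<forall>n. C n \<subseteq> carrier M \<and> rdiam M (C n) \<le> \<delta>)}.
        \<Sum>n. ennreal (unit_ball_vol (real k)) * (rdiam M (C n) / 2) ^ k)"

definition hausdorff ::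
  "('a::topological_space, 'e::euclidean_space) rchart set \<Rightarrow> nat \<Rightarrow> 'a set \<Rightarrow> ennreal" where
  "hausdorff M k E = (SUP \<delta>\<in>{0<..}. hausdorff_pre M k \<delta> E)"

definition surface_measure ::
  "('a::topological_space, real \<times> 'b::euclidean_space) rchart set \<Rightarrow> 'a measure" where
  "surface_measure M = measure_of (carrier (bdry M))
     (sets (restrict_space borel (carrier (bdry M)))) (hausdorff M (DIM('b)))"

text \<open>The measure with density \<open>w\<close>; negative values of \<open>w\<close> are truncated at 0.\<close>

definition weighted :: "('a \<Rightarrow> real) \<Rightarrow> 'a measure \<Rightarrow> 'a measure" where
  "weighted w \<nu> = density \<nu> (\<lambda>x. ennreal (w x))"

text \<open>The measure \<open>\<alpha> vol + \<beta> \<sigma>\<close> on \<open>space vol\<close>, where \<open>\<sigma>\<close> lives on a subset of \<open>space vol\<close>.\<close>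

definition bulk_surface ::
  "('a \<Rightarrow> real) \<Rightarrow> 'a measure \<Rightarrow> ('a \<Rightarrow> real) \<Rightarrow> 'a measure \<Rightarrow> 'a measure" where
  "bulk_surface \<alpha> vol \<beta> \<sigma> = measure_of (space vol) (sets vol)
     (\<lambda>E. emeasure (weighted \<alpha> vol) E + emeasure (weighted \<beta> \<sigma>) (E \<inter> space \<sigma>))"


section \<open>Variance, entropy and optimal constants\<close>

definition Var :: "'a measure \<Rightarrow> ('a \<Rightarrow> real) \<Rightarrow> real" where
  "Var \<nu> f = (\<integral>x. (f x)\<^sup>2 \<partial>\<nu>) - (\<integral>x. f x \<partial>\<nu>)\<^sup>2"

definition Ent :: "'a measure \<Rightarrow> ('a \<Rightarrow> real) \<Rightarrow> real" where
  "Ent \<nu> h = (\<integral>x. h x * ln (h x) \<partial>\<nu>) - (\<integral>x. h x \<partial>\<nu>) * ln (\<integral>x. h x \<partial>\<nu>)"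

text \<open>The optimal constants take the value \<open>\<infinity>\<close> if no constant is admissible.\<close>

definition poincare_const ::
  "('a, 'e::euclidean_space) rchart set \<Rightarrow> 'a measure \<Rightarrow> ereal" where
  "poincare_const M \<nu> =
     (INF c\<in>{c::real. \<forall>f\<in>C1 M. Var \<nu> f \<le> c * (\<integral>x. grad_sq M f x \<partial>\<nu>)}. ereal c)"

definition log_sobolev_const ::
  "('a, 'e::euclidean_space) rchart set \<Rightarrow> 'a measure \<Rightarrow> ereal" where
  "log_sobolev_const M \<nu> =
     (INF c\<in>{c::real. \<forall>f\<in>C1 M. Ent \<nu> (\<lambda>x. (f x)\<^sup>2) \<le> c * (\<integral>x. grad_sq M f x \<partial>\<nu>)}. ereal c)"

definition mixed_log_sobolev_const ::
  "('a::topological_space, real \<times> 'b::euclidean_space) rchart set \<Rightarrow>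
     ('a \<Rightarrow> real) \<Rightarrow> 'a measure \<Rightarrow> ('a \<Rightarrow> real) \<Rightarrow> 'a measure \<Rightarrow> ereal" where
  "mixed_log_sobolev_const M \<alpha> vol \<beta> \<sigma> =
     (INF c\<in>{c::real. \<forall>f\<in>C1 M. Ent (bulk_surface \<alpha> vol \<beta> \<sigma>) (\<lambda>x. (f x)\<^sup>2) \<le>
        c * ((\<integral>x. grad_sq M f x \<partial>weighted \<alpha> vol) + (\<integral>x. grad_sq (bdry M) f x \<partial>weighted \<beta> \<sigma>))}. ereal c)"

definition log_quot :: "real \<Rightarrow> real \<Rightarrow> real" where
  "log_quot A B = (if A = B then 1 / A else (ln B - ln A) / (B - A))"


section \<open>Lebesgue and Sobolev spaces\<close>

definition Lp_space :: "'a measure \<Rightarrow> real \<Rightarrow> ('a \<Rightarrow> real) set" where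
  "Lp_space \<nu> p = {f \<in> borel_measurable \<nu>. integrable \<nu> (\<lambda>x. \<bar>f x\<bar> powr p)}"

definition Lp_norm :: "'a measure \<Rightarrow> real \<Rightarrow> ('a \<Rightarrow> real) \<Rightarrow> real" where
  "Lp_norm \<nu> p f = (\<integral>x. \<bar>f x\<bar> powr p \<partial>\<nu>) powr (1 / p)"

definition C1_norm ::
  "('a, 'e::euclidean_space) rchart set \<Rightarrow> 'a measure \<Rightarrow> ('a \<Rightarrow> real) \<Rightarrow> real" where
  "C1_norm M \<nu> f = sqrt ((\<integral>x. (f x)\<^sup>2 \<partial>\<nu>) + (\<integral>x. grad_sq M f x \<partial>\<nu>))"

text \<open>\<open>W12 M \<nu>\<close> is the completion of \<open>C\<^sup>1(M)\<close> in the norm \<open>C1_norm\<close>, realised in \<open>L\<^sup>2(\<nu>)\<close>.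
  For weights that are continuous and positive almost everywhere the form is closable, so that
  the completion is a space of functions and the norm below is well defined.\<close>

definition W12_approx ::
  "('a, 'e::euclidean_space) rchart set \<Rightarrow> 'a measure \<Rightarrow> (nat \<Rightarrow> 'a \<Rightarrow> real) \<Rightarrow> ('a \<Rightarrow> real) \<Rightarrow> bool" where
  "W12_approx M \<nu> u f \<longleftrightarrow> (\<forall>n. u n \<in> C1 M) \<and>
     (\<forall>e>0. \<exists>N. \<forall>m\<ge>N. \<forall>n\<ge>N. C1_norm M \<nu> (\<lambda>x. u m x - u n x) < e) \<and>
     f \<in> Lp_space \<nu> 2 \<and> (\<lambda>n. Lp_norm \<nu> 2 (\<lambda>x. u n x - f x)) \<longlonglongrightarrow> 0"

definition W12 :: "('a, 'e::euclidean_space) rchart set \<Rightarrow> 'a measure \<Rightarrow> ('a \<Rightarrow> real) set" where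
  "W12 M \<nu> = {f. \<exists>u. W12_approx M \<nu> u f}"

definition W12_norm ::
  "('a, 'e::euclidean_space) rchart set \<Rightarrow> 'a measure \<Rightarrow> ('a \<Rightarrow> real) \<Rightarrow> real" where
  "W12_norm M \<nu> f = (THE r. \<exists>u. W12_approx M \<nu> u f \<and> (\<lambda>n. C1_norm M \<nu> (u n)) \<longlonglongrightarrow> r)"

definition W12_linear_op ::
  "('a, 'e::euclidean_space) rchart set \<Rightarrow> 'a measure \<Rightarrow> real \<Rightarrow> 'a measure \<Rightarrow>
     (('a \<Rightarrow> real) \<Rightarrow> ('a \<Rightarrow> real)) \<Rightarrow> bool" where
  "W12_linear_op M \<nu> p \<nu>' T \<longleftrightarrow> (\<forall>f\<in>W12 M \<nu>. T f \<in> Lp_space \<nu>' p) \<and>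
     (\<forall>f\<in>W12 M \<nu>. \<forall>g\<in>W12 M \<nu>. \<forall>a b.
        AE x in \<nu>'. T (\<lambda>y. a * f y + b * g y) x = a * T f x + b * T g x)"

definition W12_bounded_op ::
  "('a, 'e::euclidean_space) rchart set \<Rightarrow> 'a measure \<Rightarrow> real \<Rightarrow> 'a measure \<Rightarrow>
     (('a \<Rightarrow> real) \<Rightarrow> ('a \<Rightarrow> real)) \<Rightarrow> bool" where
  "W12_bounded_op M \<nu> p \<nu>' T \<longleftrightarrow> W12_linear_op M \<nu> p \<nu>' T \<and>
     (\<exists>K. \<forall>f\<in>W12 M \<nu>. Lp_norm \<nu>' p (T f) \<le> K * W12_norm M \<nu> f)"

definition W12_compact_op ::
  "('a, 'e::euclidean_space) rchart set \<Rightarrow> 'a measure \<Rightarrow> real \<Rightarrow> 'a measure \<Rightarrow>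
     (('a \<Rightarrow> real) \<Rightarrow> ('a \<Rightarrow> real)) \<Rightarrow> bool" where
  "W12_compact_op M \<nu> p \<nu>' T \<longleftrightarrow> W12_linear_op M \<nu> p \<nu>' T \<and>
     (\<forall>f. (\<forall>n. f n \<in> W12 M \<nu>) \<and> (\<exists>K. \<forall>n. W12_norm M \<nu> (f n) \<le> K) \<longrightarrow>
        (\<exists>r g. strict_mono (r::nat \<Rightarrow> nat) \<and> g \<in> Lp_space \<nu>' p \<and>
           (\<lambda>n. Lp_norm \<nu>' p (\<lambda>x. T (f (r n)) x - g x)) \<longlonglongrightarrow> 0))"

definition compact_trace ::
  "('a, 'e::euclidean_space) rchart set \<Rightarrow> 'a measure \<Rightarrow> 'a measure \<Rightarrow> bool" where
  "compact_trace M \<nu> \<nu>' \<longleftrightarrow>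
     (\<exists>T. W12_compact_op M \<nu> 2 \<nu>' T \<and> (\<forall>f\<in>C1 M. AE x in \<nu>'. T f x = f x))"

end

theory Submission
  imports Defs "HOL-Real_Asymp.Real_Asymp"
begin

text \<open>The measure \<open>\<mu> = \<alpha> vol + \<beta> \<sigma>\<close> is the mixture \<open>A \<nu> + B \<rho>\<close> of the normalised bulk measure
  \<open>\<nu>\<close> and the normalised surface measure \<open>\<rho>\<close>. With \<open>x\<close> and \<open>y\<close> the integrals of \<open>f\<^sup>2\<close> with
  respect to \<open>\<nu>\<close> and \<open>\<rho>\<close>, the entropy of \<open>f\<^sup>2\<close> under \<open>\<mu>\<close> is \<open>A Ent\<^sub>\<nu> + B Ent\<^sub>\<rho>\<close> plus the
  entropy of the pair \<open>(x, y)\<close> on the two-point space with masses \<open>A\<close> and \<open>B\<close>. The sharp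
  logarithmic Sobolev inequality on that space bounds the last term by
  \<open>A B log_quot A B (sqrt x - sqrt y)\<^sup>2\<close>, and the Cauchy--Schwarz inequality gives
  \<open>(sqrt x - sqrt y)\<^sup>2 \<le> Var\<^sub>\<nu> f + Var\<^sub>\<rho> f + (mean\<^sub>\<nu> f - mean\<^sub>\<rho> f)\<^sup>2\<close>; this is
  \<open>Ent_mixture_le\<close>. Each term is now controlled by a Dirichlet energy. The boundary entropy
  and the boundary variance can be estimated either by the bulk energy or by the boundary
  energy, and \<open>s\<close> and \<open>t\<close> are the weights in the convex combinations of the two.
  Comparing coefficients gives the maximum.

  The analytic core is the two-point inequality \<open>two_point_log_sobolev\<close>. If \<open>a\<close>, \<open>b\<close> are the
  values of a probability density, so \<open>p a + q b = 1\<close>, then the inequality says that a binary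
  quadratic form with coefficients in \<open>ln a\<close> and \<open>ln b\<close> is nonnegative, and the determinant
  criterion turns this into \<open>q / ln a + p / ln b \<ge> (q - p) / (ln q - ln p)\<close>. Since
  \<open>1 / ln w - 1 / (w - 1)\<close> extends to a convex function on the positive half-line
  (\<open>convex_recip_ln_reg\<close>), the left-hand side is convex along the segment, and its minimum is
  attained where \<open>a = q / p\<close> and \<open>b = p / q\<close>.

  The geometry enters through three facts: \<open>C\<^sup>1\<close> functions are continuous, hence bounded on
  the compact manifold; they restrict to \<open>C\<^sup>1\<close> functions on the boundary; and gradients have
  nonnegative squared length.\<close>

section \<open>Convexity of the reciprocal logarithm without its pole\<close>

lemma min_at_zero_of_deriv_sign:
  fixes f f' :: "real \<Rightarrow> real"
  assumes d: "\<And>t. t > c \<Longrightarrow> (f has_real_derivative f' t) (at t)"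
    and pos: "\<And>t. t \<ge> 0 \<Longrightarrow> f' t \<ge> 0" and neg: "\<And>t. c < t \<Longrightarrow> t \<le> 0 \<Longrightarrow> f' t \<le> 0"
    and "c < 0" "c < x"
  shows "f 0 \<le> f x"
proof (cases "x \<ge> 0")
  case True
  show ?thesis
  proof (rule DERIV_nonneg_imp_nondecreasing[OF True])
    show "\<exists>y. (f has_real_derivative y) (at t) \<and> 0 \<le> y" if "0 \<le> t" for t
      using d[of t] pos[of t] that \<open>c < 0\<close> by auto
  qed
next
  case False
  show ?thesis
  proof (rule DERIV_nonpos_imp_nonincreasing[of x 0])
    show "\<exists>y. (f has_real_derivative y) (at t) \<and> y \<le> 0" if "x \<le> t" "t \<le> 0" for t
      using d[of t] neg[of t] that \<open>c < x\<close> by auto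
  qed (use False in simp)
qed

text \<open>The difference of the two sides vanishes to third order at \<open>0\<close>, and its third derivative
  is \<open>exp L * L * (6 + L)\<close>, which has the sign of \<open>L\<close> beyond \<open>-6\<close>. Integrating three times
  from \<open>0\<close> gives nonnegativity on both sides of the origin.\<close>

lemma exp_rational_bound:
  fixes L :: real
  assumes "L > -6"
  shows "exp L * (6 - L\<^sup>2) \<le> 6 + 6 * L + 2 * L\<^sup>2"
proof -
  define J where "J L = 6 + 6 * L + 2 * L\<^sup>2 - exp L * (6 - L\<^sup>2)" for L :: real
  define J1 where "J1 L = 6 + 4 * L - exp L * (6 - 2 * L - L\<^sup>2)" for L :: real
  define J2 where "J2 L = 4 - exp L * (4 - 4 * L - L\<^sup>2)" for L :: real
  have dJ: "(J has_real_derivative J1 t) (at t)" for t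
    unfolding J_def J1_def
    by (auto intro!: derivative_eq_intros simp: algebra_simps power2_eq_square)
  have dJ1: "(J1 has_real_derivative J2 t) (at t)" for t
    unfolding J1_def J2_def
    by (auto intro!: derivative_eq_intros simp: algebra_simps power2_eq_square)
  have dJ2: "(J2 has_real_derivative exp t * (t * (6 + t))) (at t)" for t
    unfolding J2_def
    by (auto intro!: derivative_eq_intros simp: algebra_simps power2_eq_square)
  have "J2 0 \<le> J2 t" if "t > -6" for t
    by (rule min_at_zero_of_deriv_sign[where c = "-6", OF dJ2 _ _ _ that])
       (auto simp: zero_le_mult_iff mult_le_0_iff)
  then have J2: "J2 t \<ge> 0" if "t > -6" for t
    using that by (force simp: J2_def)
  have J1_mono: "J1 s \<le> J1 t" if "-6 < s" "s \<le> t" for s t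
    by (rule DERIV_nonneg_imp_nondecreasing[OF that(2)]) (use dJ1 J2 that in force)
  have "J 0 \<le> J L"
    by (rule min_at_zero_of_deriv_sign[where c = "-6", OF dJ _ _ _ assms])
       (use J1_mono[of 0] J1_mono[of _ 0] in \<open>auto simp: J1_def\<close>)
  then show ?thesis
    by (simp add: J_def)
qed

text \<open>The left-hand side is the derivative of the logarithm of the quotient
  \<open>(2 + L) (exp L - 1)^3 / (2 exp L ^ 2 L^3)\<close>, whose monotonicity yields the next inequality.\<close>

lemma log_deriv_nonneg:
  fixes L :: real
  assumes "L > -2" "L \<noteq> 0"
  shows "1 / (2 + L) - 2 + 3 * (exp L / (exp L - 1) - 1 / L) \<ge> 0"
proof -
  have ne: "exp L - 1 \<noteq> 0" "2 + L \<noteq> 0" using assms by auto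
  have pos: "(exp L - 1) * L > 0"
    using assms by (cases "L > 0") (auto simp: mult_neg_neg)
  have "1 / (2 + L) - 2 + 3 * (exp L / (exp L - 1) - 1 / L)
      = (6 + 6 * L + 2 * L\<^sup>2 - exp L * (6 - L\<^sup>2)) / ((2 + L) * ((exp L - 1) * L))"
    using ne assms
    by (simp add: divide_simps power2_eq_square) (simp add: algebra_simps)
  also have "\<dots> \<ge> 0"
    using exp_rational_bound[of L] pos assms by (intro divide_nonneg_pos mult_pos_pos[OF _ pos]) auto
  finally show ?thesis .
qed

text \<open>With \<open>w = exp L\<close> this is the convexity of \<open>1 / ln w - 1 / (w - 1)\<close>. The quotient of the
  right-hand side by the left-hand side tends to \<open>1\<close> at \<open>L = 0\<close> and is increasing on
  \<open>{-2<..}\<close>, so it is at least \<open>1\<close> for \<open>L > 0\<close> and at most \<open>1\<close> for \<open>-2 < L < 0\<close>; in the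
  latter range the left-hand side is negative, which turns the inequality round again. For
  \<open>L \<le> -2\<close> the two sides have opposite signs.\<close>

lemma ln_cubed_le_diff_cubed:
  fixes L :: real
  shows "2 * exp L ^ 2 * L ^ 3 \<le> (2 + L) * (exp L - 1) ^ 3"
proof -
  define F where "F L = ln (2 + L) - ln 2 - 2 * L + 3 * ln ((exp L - 1) / L)" for L :: real
  have ratio_pos: "(exp t - 1) / t > 0" if "t \<noteq> 0" for t :: real
    using that by (cases "t > 0") (auto simp: divide_neg_neg)
  have dF: "(F has_real_derivative (1 / (2 + t) - 2 + 3 * (exp t / (exp t - 1) - 1 / t))) (at t)"
    if "t > -2" "t \<noteq> 0" for t
  proof -
    have "exp t - 1 \<noteq> 0" using that by simp
    then show ?thesis
    unfolding F_def using that ratio_pos[of t]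
    by (auto intro!: derivative_eq_intros simp: divide_simps)
  qed
  have lim_r: "(F \<longlongrightarrow> 0) (at_right 0)" and lim_l: "(F \<longlongrightarrow> 0) (at_left 0)"
  proof -
    have r: "((\<lambda>L::real. (exp L - 1) / L) \<longlongrightarrow> 1) (at 0)"
      by real_asymp
    have "(F \<longlongrightarrow> ln (2 + 0) - ln 2 - 2 * 0 + 3 * ln 1) (at 0)"
      unfolding F_def by (intro tendsto_intros r) auto
    then have "(F \<longlongrightarrow> 0) (at 0)" by simp
    then show "(F \<longlongrightarrow> 0) (at_right 0)" "(F \<longlongrightarrow> 0) (at_left 0)"
      by (auto intro: filterlim_mono at_le)
  qed
  have F_mono: "F s \<le> F t" if "-2 < s" "s \<le> t" "t < 0 \<or> 0 < s" for s t
  proof (rule DERIV_nonneg_imp_nondecreasing[OF that(2)])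
    show "\<exists>y. (F has_real_derivative y) (at x) \<and> 0 \<le> y" if "s \<le> x" "x \<le> t" for x
    proof -
      have "x > -2" "x \<noteq> 0"
        using that \<open>-2 < s\<close> \<open>t < 0 \<or> 0 < s\<close> by auto
      then show ?thesis using dF[of x] log_deriv_nonneg[of x] by blast
    qed
  qed
  have expF: "exp (F L) * (2 * exp L ^ 2 * L ^ 3) = (2 + L) * (exp L - 1) ^ 3"
    if "L > -2" "L \<noteq> 0" for L
  proof -
    have "exp (F L) = (2 + L) / 2 / exp (2 * L) * ((exp L - 1) / L) ^ 3"
      unfolding F_def using that ratio_pos[of L] exp_of_nat_mult[of 3 "ln ((exp L - 1) / L)"]
      by (simp add: exp_add exp_diff)
    also have "exp (2 * L) = exp L ^ 2"
      by (simp add: exp_double)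
    finally show ?thesis using that by (simp add: field_simps power_divide)
  qed
  consider "L \<le> -2" | "-2 < L" "L < 0" | "L = 0" | "L > 0" by linarith
  then show ?thesis
  proof cases
    case 1
    then have "2 * exp L ^ 2 * L ^ 3 \<le> 0"
      by (intro mult_nonneg_nonpos) (auto simp: power3_eq_cube mult_nonneg_nonpos mult_nonpos_nonpos)
    also have "0 \<le> (2 + L) * (exp L - 1) ^ 3"
      using 1 by (intro mult_nonpos_nonpos) (auto simp: power_le_zero_eq)
    finally show ?thesis .
  next
    case 2
    have "F L \<le> 0"
      by (rule tendsto_lowerbound[OF lim_l])
         (use 2 in \<open>auto simp: eventually_at_left_field intro!: F_mono exI[of _ L]\<close>)
    then have "exp (F L) \<le> 1" by simp
    moreover have "2 * exp L ^ 2 * L ^ 3 \<le> 0"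
      using 2 by (intro mult_nonneg_nonpos) (auto simp: power_le_zero_eq)
    ultimately have "1 * (2 * exp L ^ 2 * L ^ 3) \<le> exp (F L) * (2 * exp L ^ 2 * L ^ 3)"
      by (intro mult_right_mono_neg)
    then show ?thesis using expF[of L] 2 by simp
  next
    case 3
    then show ?thesis by simp
  next
    case 4
    have "0 \<le> F L"
      by (rule tendsto_upperbound[OF lim_r])
         (use 4 in \<open>auto simp: eventually_at_right_field intro!: F_mono exI[of _ L]\<close>)
    then have "1 \<le> exp (F L)" by simp
    then have "1 * (2 * exp L ^ 2 * L ^ 3) \<le> exp (F L) * (2 * exp L ^ 2 * L ^ 3)"
      using 4 by (intro mult_right_mono) auto
    then show ?thesis using expF[of L] 4 by simp
  qed
qed

text \<open>The reciprocal logarithm with its simple pole at \<open>1\<close> removed. The value at \<open>1\<close> is the limit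
  there, and \<open>- 1 / 12\<close> below is the limit of the derivative.\<close>

definition recip_ln_reg :: "real \<Rightarrow> real" where
  "recip_ln_reg w = (if w = 1 then 1 / 2 else 1 / ln w - 1 / (w - 1))"

definition recip_ln_reg' :: "real \<Rightarrow> real" where
  "recip_ln_reg' w = (if w = 1 then - 1 / 12 else 1 / (w - 1)\<^sup>2 - 1 / (w * (ln w)\<^sup>2))"

lemma DERIV_recip_ln_reg:
  assumes "w > 0"
  shows "(recip_ln_reg has_real_derivative recip_ln_reg' w) (at w)"
proof (cases "w = 1")
  case False
  have "((\<lambda>w. 1 / ln w - 1 / (w - 1)) has_real_derivative recip_ln_reg' w) (at w)"
    using assms False unfolding recip_ln_reg'_def
    by (auto intro!: derivative_eq_intros simp: power2_eq_square)
  then show ?thesis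
    by (rule has_field_derivative_transform_within_open[where S = "- {1}"])
       (use False in \<open>auto simp: recip_ln_reg_def\<close>)
next
  case True
  have "((\<lambda>h. (1 / ln (1 + h) - 1 / h - 1 / 2) / h) \<longlongrightarrow> - 1 / 12) (at (0::real))"
    by real_asymp
  then have "((\<lambda>h. (recip_ln_reg (1 + h) - recip_ln_reg 1) / h) \<longlongrightarrow> - 1 / 12) (at 0)"
    by (rule Lim_transform_eventually)
       (auto simp: recip_ln_reg_def eventually_at_filter)
  then show ?thesis
    using True by (simp add: DERIV_def recip_ln_reg'_def)
qed

lemma isCont_recip_ln_reg':
  assumes "w > 0"
  shows "isCont recip_ln_reg' w"
proof (cases "w = 1")
  case False
  have "isCont (\<lambda>w. 1 / (w - 1)\<^sup>2 - 1 / (w * (ln w)\<^sup>2)) w"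
    using assms False by (auto intro!: continuous_intros)
  moreover have "\<forall>\<^sub>F x in nhds w. 1 / (x - 1)\<^sup>2 - 1 / (x * (ln x)\<^sup>2) = recip_ln_reg' x"
    using eventually_nhds_in_open[of "- {1}" w] False
    by (auto simp: recip_ln_reg'_def elim!: eventually_mono)
  ultimately show ?thesis
    using isCont_cong by fast
next
  case True
  have "((\<lambda>w. 1 / (w - 1)\<^sup>2 - 1 / (w * (ln w)\<^sup>2)) \<longlongrightarrow> - 1 / 12) (at (1::real))"
    by real_asymp
  then have "(recip_ln_reg' \<longlongrightarrow> - 1 / 12) (at 1)"
    by (rule Lim_transform_eventually)
       (auto simp: recip_ln_reg'_def eventually_at_filter)
  then show ?thesis
    using True by (simp add: isCont_def recip_ln_reg'_def)
qed

lemma DERIV_recip_ln_reg':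
  assumes "w > 0" "w \<noteq> 1"
  shows "\<exists>y. (recip_ln_reg' has_real_derivative y) (at w) \<and> y \<ge> 0"
proof -
  define L where "L = ln w"
  have w: "w = exp L" and L: "L \<noteq> 0" using assms by (auto simp: L_def)
  let ?y = "(2 + L) / (w ^ 2 * L ^ 3) - 2 / (w - 1) ^ 3"
  have "((\<lambda>w. 1 / (w - 1)\<^sup>2) has_real_derivative - 2 / (w - 1) ^ 3) (at w)"
    using assms by (auto intro!: derivative_eq_intros simp: divide_simps power2_eq_square power3_eq_cube)
  moreover have "((\<lambda>w. 1 / (w * (ln w)\<^sup>2)) has_real_derivative - (2 + L) / (w\<^sup>2 * L ^ 3)) (at w)"
    using assms L unfolding L_def
    by (auto intro!: derivative_eq_intros simp: divide_simps power2_eq_square power3_eq_cube)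
       (simp add: algebra_simps)
  ultimately have "((\<lambda>w. 1 / (w - 1)\<^sup>2 - 1 / (w * (ln w)\<^sup>2)) has_real_derivative ?y) (at w)"
    by (auto intro: DERIV_diff[THEN DERIV_cong] simp: diff_divide_distrib add_divide_distrib)
  then have "(recip_ln_reg' has_real_derivative ?y) (at w)"
    by (rule has_field_derivative_transform_within_open[where S = "- {1}"])
       (use assms in \<open>auto simp: recip_ln_reg'_def\<close>)
  moreover have "?y \<ge> 0"
  proof -
    have "L * (w - 1) > 0"
      using L by (cases "L > 0") (auto simp: w mult_neg_neg)
    then have "w ^ 2 * (L * (w - 1)) ^ 3 > 0"
      using assms by simp
    moreover have "?y = ((2 + L) * (w - 1) ^ 3 - 2 * w ^ 2 * L ^ 3) / (w ^ 2 * (L * (w - 1)) ^ 3)"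
      using assms L by (simp add: divide_simps power_mult_distrib)
    ultimately show ?thesis
      using ln_cubed_le_diff_cubed[of L] by (simp add: w)
  qed
  ultimately show ?thesis by blast
qed

text \<open>The second derivative is nonnegative on either side of \<open>1\<close> and the first derivative is
  continuous at \<open>1\<close>, so the first derivative is monotone on all of \<open>{0<..}\<close>.\<close>

lemma convex_recip_ln_reg: "convex_on {0<..} recip_ln_reg"
proof (rule convex_on_realI)
  fix x y :: real assume xy: "x \<in> {0<..}" "y \<in> {0<..}" "x \<le> y"
  have mono: "recip_ln_reg' a \<le> recip_ln_reg' b"
    if "0 < a" "a < b" "b \<le> 1 \<or> 1 \<le> a" for a b
  proof (rule DERIV_nonneg_imp_increasing_open[OF less_imp_le[OF that(2)]])
    show "\<exists>y. (recip_ln_reg' has_real_derivative y) (at x) \<and> 0 \<le> y" if "a < x" "x < b" for x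
      using DERIV_recip_ln_reg'[of x] that \<open>0 < a\<close> \<open>b \<le> 1 \<or> 1 \<le> a\<close> by auto
    show "continuous_on {a..b} recip_ln_reg'"
      using isCont_recip_ln_reg' \<open>0 < a\<close> by (intro continuous_at_imp_continuous_on) auto
  qed
  consider "x = y" | "x < y" "y \<le> 1 \<or> 1 \<le> x" | "x < 1" "1 < y"
    using xy by linarith
  then show "recip_ln_reg' x \<le> recip_ln_reg' y"
  proof cases
    case 3
    then show ?thesis using mono[of x 1] mono[of 1 y] xy by simp
  qed (use xy mono[of x y] in auto)
qed (auto intro: DERIV_recip_ln_reg)

lemma recip_ln_reg_above_tangent:
  assumes "a > 0" "r > 0"
  shows "recip_ln_reg r + recip_ln_reg' r * (a - r) \<le> recip_ln_reg a"
proof -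
  have "recip_ln_reg a - recip_ln_reg r \<ge> recip_ln_reg' r * (a - r)"
    by (rule convex_on_imp_above_tangent[OF convex_recip_ln_reg])
       (use assms in \<open>auto simp: interior_open intro: DERIV_recip_ln_reg has_field_derivative_at_within\<close>)
  then show ?thesis by simp
qed

lemma log_quot_pos:
  assumes "p > 0" "q > 0"
  shows "log_quot p q > 0"
  using assms by (cases "p < q") (auto simp: log_quot_def divide_neg_neg)

text \<open>On the segment \<open>p a + q b = 1\<close> the poles of \<open>q / ln a\<close> and \<open>p / ln b\<close> at \<open>a = b = 1\<close> cancel,
  so the right-hand side equals \<open>q K a + p K b\<close>, where \<open>K\<close> is the convex function above. The
  minimum is at \<open>a = r = q / p\<close>, \<open>b = 1 / r\<close>: the tangent slopes there cancel along the
  segment because \<open>K' (1 / r) = r\<^sup>2 K' r\<close>, and the minimal value is the logarithmic mean of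
  \<open>p\<close> and \<open>q\<close>.\<close>

lemma harmonic_ln_lower_bound:
  fixes p q a b :: real
  assumes "p > 0" "q > 0" "p + q = 1" "a > 0" "b > 0" "p * a + q * b = 1" "a \<noteq> 1"
  shows "1 / log_quot p q \<le> q / ln a + p / ln b"
proof -
  define r where "r = q / p"
  have r: "r > 0" "1 / r > 0" using assms by (auto simp: r_def)
  have "b = (p + q - p * a) / q" using assms by (simp add: field_simps)
  then have b1: "b - 1 = - (p / q) * (a - 1)" and br: "b - 1 / r = - (p / q) * (a - r)"
    using assms(1,2)
    by (simp_all add: r_def add_divide_distrib diff_divide_distrib right_diff_distrib)
  have "b \<noteq> 1" using b1 assms by auto
  have slope: "recip_ln_reg' (1 / r) = r\<^sup>2 * recip_ln_reg' r"
  proof (cases "r = 1")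
    case False
    then have "(1 / r - 1)\<^sup>2 = (r - 1)\<^sup>2 / r\<^sup>2" "1 / r \<noteq> 1" "ln r \<noteq> 0"
      using r by (auto simp: field_simps power2_eq_square)
    then show ?thesis
      using False r by (simp add: recip_ln_reg'_def ln_div right_diff_distrib power2_eq_square)
  qed simp
  have at_min: "q * recip_ln_reg r + p * recip_ln_reg (1 / r) = 1 / log_quot p q"
  proof (cases "p = q")
    case True
    then show ?thesis using assms by (simp add: r_def recip_ln_reg_def log_quot_def)
  next
    case False
    then have "r \<noteq> 1" "1 / r \<noteq> 1" using assms by (auto simp: r_def)
    define D where "D = ln q - ln p"
    have ln: "ln r = D" "ln (1 / r) = - D"
      using assms by (auto simp: r_def ln_div D_def)
    have rational: "q / (r - 1) + p / (1 / r - 1) = 0"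
      using False assms by (simp add: r_def divide_simps) (simp add: algebra_simps)
    have "q * recip_ln_reg r + p * recip_ln_reg (1 / r)
        = q * (1 / D - 1 / (r - 1)) + p * (1 / (- D) - 1 / (1 / r - 1))"
      using \<open>r \<noteq> 1\<close> \<open>1 / r \<noteq> 1\<close> by (simp only: recip_ln_reg_def ln if_False)
    also have "\<dots> = (q - p) / D - (q / (r - 1) + p / (1 / r - 1))"
      by (simp only: right_diff_distrib diff_divide_distrib) simp
    also have "\<dots> = 1 / log_quot p q"
      using False by (simp add: rational log_quot_def D_def)
    finally show ?thesis .
  qed
  have "1 / log_quot p q = q * (recip_ln_reg r + recip_ln_reg' r * (a - r))
      + p * (recip_ln_reg (1 / r) + recip_ln_reg' (1 / r) * (b - 1 / r))"
    unfolding at_min[symmetric] slope br using assms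
    by (simp add: r_def field_simps power2_eq_square)
  also have "\<dots> \<le> q * recip_ln_reg a + p * recip_ln_reg b"
    using assms r by (intro add_mono mult_left_mono recip_ln_reg_above_tangent) auto
  also have "\<dots> = q / ln a + p / ln b"
  proof -
    have "p / (b - 1) = - (q / (a - 1))"
      unfolding b1 using assms(1,2,7) by simp
    then show ?thesis
      using \<open>a \<noteq> 1\<close> \<open>b \<noteq> 1\<close> by (simp add: recip_ln_reg_def right_diff_distrib)
  qed
  finally show ?thesis .
qed

section \<open>The logarithmic Sobolev inequality on a two-point space\<close>

lemma quadratic_form_nonneg:
  fixes \<alpha> \<beta> \<gamma> u v :: real
  assumes "\<alpha> > 0" "\<beta>\<^sup>2 \<le> \<alpha> * \<gamma>"
  shows "\<alpha> * u\<^sup>2 + 2 * \<beta> * u * v + \<gamma> * v\<^sup>2 \<ge> 0"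
proof -
  have "\<alpha> * (\<alpha> * u\<^sup>2 + 2 * \<beta> * u * v + \<gamma> * v\<^sup>2) = (\<alpha> * u + \<beta> * v)\<^sup>2 + (\<alpha> * \<gamma> - \<beta>\<^sup>2) * v\<^sup>2"
    by (simp add: power2_eq_square algebra_simps)
  also have "\<dots> \<ge> 0" using assms by simp
  finally show ?thesis using assms(1) by (simp add: zero_le_mult_iff)
qed

text \<open>After normalising the second moment, \<open>a\<close> and \<open>b\<close> are densities with \<open>p a + q b = 1\<close>, and
  the entropy is the quadratic form \<open>p ln a u\<^sup>2 + q ln b v\<^sup>2\<close>. Keeping \<open>ln a\<close> and \<open>ln b\<close> as
  coefficients, the claim is that a quadratic form in \<open>(u, v)\<close> is nonnegative; its determinant
  condition is \<open>c (p ln a + q ln b) \<le> ln a * ln b\<close>, that is the lower bound on \<open>q / ln a + p / ln b\<close>.\<close>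

lemma two_point_log_sobolev_pos:
  fixes p q u v :: real
  assumes pq: "p > 0" "q > 0" "p + q = 1" and uv: "u > 0" "v > 0"
  shows "p * (u\<^sup>2 * ln (u\<^sup>2)) + q * (v\<^sup>2 * ln (v\<^sup>2)) - (p * u\<^sup>2 + q * v\<^sup>2) * ln (p * u\<^sup>2 + q * v\<^sup>2)
    \<le> p * q * log_quot p q * (u - v)\<^sup>2"
proof -
  define m where "m = p * u\<^sup>2 + q * v\<^sup>2"
  have m: "m > 0" using assms by (simp add: m_def add_pos_pos)
  define a b where "a = u\<^sup>2 / m" and "b = v\<^sup>2 / m"
  define c where "c = log_quot p q"
  have c: "c > 0" using log_quot_pos pq by (simp add: c_def)
  have ab: "a > 0" "b > 0" "p * a + q * b = 1"
    using m uv by (auto simp: a_def b_def m_def add_divide_distrib[symmetric])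
  have ent: "p * (u\<^sup>2 * ln (u\<^sup>2)) + q * (v\<^sup>2 * ln (v\<^sup>2)) - m * ln m
      = p * ln a * u\<^sup>2 + q * ln b * v\<^sup>2"
    using m uv by (simp add: a_def b_def ln_div) (simp add: m_def algebra_simps)
  have "p * ln a * u\<^sup>2 + q * ln b * v\<^sup>2 \<le> p * q * c * (u - v)\<^sup>2"
  proof (cases "a = 1")
    case True
    have "q * b = q" using ab(3) pq(3) unfolding True by linarith
    then have "b = 1" using pq by simp
    then show ?thesis using True c pq by simp
  next
    case False
    have "b = (p + q - p * a) / q" using ab pq by (simp add: field_simps)
    then have "b - 1 = - (p / q) * (a - 1)" using pq(1,2) by (simp add: field_simps)
    then have "(a - 1) * (b - 1) = - (p / q * (a - 1)\<^sup>2)"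
      by (simp add: power2_eq_square)
    then have "(a - 1) * (b - 1) < 0"
      using False pq by simp
    \<comment> \<open>The mean of \<open>a\<close> and \<open>b\<close> is \<open>1\<close>, so the logarithms have opposite signs; this is what
      reverses the inequality when multiplying by \<open>ln a * ln b\<close>, and it makes one diagonal
      coefficient of the quadratic form positive.\<close>
    then have signs: "ln a < 0 \<and> ln b > 0 \<or> ln a > 0 \<and> ln b < 0"
      using ab by (auto simp: mult_less_0_iff)
    then have prod: "ln a * ln b < 0" by (auto simp: mult_less_0_iff)
    have "1 / c \<le> (p * ln a + q * ln b) / (ln a * ln b)"
      using harmonic_ln_lower_bound[of p q a b] pq ab False signs
      by (auto simp: c_def add_divide_distrib add_ac)
    then have det: "c * (p * ln a + q * ln b) \<le> ln a * ln b"
      using prod c by (simp add: field_simps)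
    have "(- (p * q * c))\<^sup>2 \<le> (p * (q * c - ln a)) * (q * (p * c - ln b))"
    proof -
      have "(p * (q * c - ln a)) * (q * (p * c - ln b)) - (- (p * q * c))\<^sup>2
          = p * q * (ln a * ln b - c * (p * ln a + q * ln b))"
        by (simp add: power2_eq_square algebra_simps)
      also have "\<dots> \<ge> 0" using det pq by simp
      finally show ?thesis by simp
    qed
    note D = this
    have "0 \<le> p * (q * c - ln a) * u\<^sup>2 + 2 * (- (p * q * c)) * u * v + q * (p * c - ln b) * v\<^sup>2"
      using signs
    proof
      assume "ln a < 0 \<and> ln b > 0"
      then have "p * (q * c - ln a) > 0" using pq c by (simp add: add_pos_pos diff_less_eq less_trans[of _ 0])
      from quadratic_form_nonneg[OF this D] show ?thesis .
    next
      assume "ln a > 0 \<and> ln b < 0"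
      then have "q * (p * c - ln b) > 0" using pq c by (simp add: add_pos_pos less_trans[of _ 0])
      from quadratic_form_nonneg[OF this, of "- (p * q * c)" "p * (q * c - ln a)" v u] D
      show ?thesis by (simp add: mult_ac add_ac)
    qed
    then show ?thesis
      by (simp add: power2_eq_square algebra_simps)
  qed
  then show ?thesis
    using ent by (simp add: m_def c_def)
qed

text \<open>The logarithmic Sobolev inequality with sharp constant on a two-point space of masses
  \<open>p\<close> and \<open>q\<close>. Functions that vanish at a point are approximated by positive ones.\<close>

lemma two_point_log_sobolev:
  fixes p q u v :: real
  assumes pq: "p > 0" "q > 0" "p + q = 1" and uv: "u \<ge> 0" "v \<ge> 0"
  shows "p * (u\<^sup>2 * ln (u\<^sup>2)) + q * (v\<^sup>2 * ln (v\<^sup>2)) - (p * u\<^sup>2 + q * v\<^sup>2) * ln (p * u\<^sup>2 + q * v\<^sup>2)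
    \<le> p * q * log_quot p q * (u - v)\<^sup>2"
proof -
  have lim: "((\<lambda>e. (w + e)\<^sup>2 * ln ((w + e)\<^sup>2)) \<longlongrightarrow> w\<^sup>2 * ln (w\<^sup>2)) (at_right 0)"
    if "w \<ge> 0" for w :: real
  proof (cases "w = 0")
    case True
    have "((\<lambda>e::real. e\<^sup>2 * ln (e\<^sup>2)) \<longlongrightarrow> 0) (at_right 0)" by real_asymp
    then show ?thesis using True by simp
  next
    case False
    then show ?thesis by (auto intro!: tendsto_eq_intros)
  qed
  show ?thesis
  proof (cases "u = 0 \<and> v = 0")
    case False
    then have m: "p * u\<^sup>2 + q * v\<^sup>2 \<noteq> 0"
      using pq uv by (auto simp: add_nonneg_eq_0_iff)
    show ?thesis
    proof (rule tendsto_le)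
      show "((\<lambda>e. p * q * log_quot p q * ((u + e) - (v + e))\<^sup>2) \<longlongrightarrow> p * q * log_quot p q * (u - v)\<^sup>2) (at_right 0)"
        by simp
      show "((\<lambda>e. p * ((u + e)\<^sup>2 * ln ((u + e)\<^sup>2)) + q * ((v + e)\<^sup>2 * ln ((v + e)\<^sup>2))
          - (p * (u + e)\<^sup>2 + q * (v + e)\<^sup>2) * ln (p * (u + e)\<^sup>2 + q * (v + e)\<^sup>2))
        \<longlongrightarrow> p * (u\<^sup>2 * ln (u\<^sup>2)) + q * (v\<^sup>2 * ln (v\<^sup>2)) - (p * u\<^sup>2 + q * v\<^sup>2) * ln (p * u\<^sup>2 + q * v\<^sup>2)) (at_right 0)"
        using m by (intro tendsto_diff tendsto_add tendsto_mult lim uv tendsto_const tendsto_ln)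
          (auto intro!: tendsto_eq_intros)
      show "\<forall>\<^sub>F e in at_right 0. p * ((u + e)\<^sup>2 * ln ((u + e)\<^sup>2)) + q * ((v + e)\<^sup>2 * ln ((v + e)\<^sup>2))
          - (p * (u + e)\<^sup>2 + q * (v + e)\<^sup>2) * ln (p * (u + e)\<^sup>2 + q * (v + e)\<^sup>2)
          \<le> p * q * log_quot p q * ((u + e) - (v + e))\<^sup>2"
        using eventually_at_right_less[of "0::real"]
        by eventually_elim (rule two_point_log_sobolev_pos, use pq uv in auto)
    qed simp
  qed simp
qed

section \<open>Variance and entropy of mixtures\<close>

lemma Var_nonneg:
  assumes "prob_space \<nu>" "integrable \<nu> f" "integrable \<nu> (\<lambda>x. (f x)\<^sup>2)"
  shows "Var \<nu> f \<ge> 0"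
proof -
  interpret prob_space \<nu> by fact
  show ?thesis
    using variance_positive[of f] variance_eq[OF assms(2,3)] by (simp add: Var_def)
qed

text \<open>Expanding both sides reduces the claim to \<open>m n \<le> sqrt x * sqrt y\<close> for the means \<open>m, n\<close> and
  second moments \<open>x, y\<close>, which holds because \<open>m\<^sup>2 \<le> x\<close> and \<open>n\<^sup>2 \<le> y\<close>.\<close>

lemma sqrt_second_moments_dist_le:
  assumes "prob_space \<nu>" "integrable \<nu> f" "integrable \<nu> (\<lambda>x. (f x)\<^sup>2)"
    and "prob_space \<rho>" "integrable \<rho> f" "integrable \<rho> (\<lambda>x. (f x)\<^sup>2)"
  shows "(sqrt (\<integral>x. (f x)\<^sup>2 \<partial>\<nu>) - sqrt (\<integral>x. (f x)\<^sup>2 \<partial>\<rho>))\<^sup>2 \<le>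
    Var \<nu> f + Var \<rho> f + ((\<integral>x. f x \<partial>\<nu>) - (\<integral>x. f x \<partial>\<rho>))\<^sup>2"
proof -
  let ?m = "\<integral>x. f x \<partial>\<nu>" and ?n = "\<integral>x. f x \<partial>\<rho>"
    and ?x = "\<integral>x. (f x)\<^sup>2 \<partial>\<nu>" and ?y = "\<integral>x. (f x)\<^sup>2 \<partial>\<rho>"
  have mx: "?m\<^sup>2 \<le> ?x" and ny: "?n\<^sup>2 \<le> ?y"
    using Var_nonneg[OF assms(1-3)] Var_nonneg[OF assms(4-6)] by (simp_all add: Var_def)
  have nonneg: "?x \<ge> 0" "?y \<ge> 0" by simp_all
  have "?m * ?n \<le> \<bar>?m\<bar> * \<bar>?n\<bar>" by (simp flip: abs_mult)
  also have "\<dots> \<le> sqrt ?x * sqrt ?y"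
    using mx ny by (intro mult_mono real_le_rsqrt) auto
  finally show ?thesis
    using nonneg by (simp add: Var_def power2_diff)
qed

text \<open>The entropy of a mixture is the mixture of the entropies plus the entropy, on the two-point
  space of masses \<open>p, q\<close>, of the pair of second moments. The two-point logarithmic Sobolev
  inequality is applied to their square roots.\<close>

lemma Ent_mixture_le:
  assumes pq: "p > 0" "q > 0" "p + q = 1"
    and \<nu>: "prob_space \<nu>" "integrable \<nu> f" "integrable \<nu> (\<lambda>x. (f x)\<^sup>2)"
    and \<rho>: "prob_space \<rho>" "integrable \<rho> f" "integrable \<rho> (\<lambda>x. (f x)\<^sup>2)"
    and mix: "(\<integral>x. (f x)\<^sup>2 \<partial>\<mu>) = p * (\<integral>x. (f x)\<^sup>2 \<partial>\<nu>) + q * (\<integral>x. (f x)\<^sup>2 \<partial>\<rho>)"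
      "(\<integral>x. (f x)\<^sup>2 * ln ((f x)\<^sup>2) \<partial>\<mu>) =
         p * (\<integral>x. (f x)\<^sup>2 * ln ((f x)\<^sup>2) \<partial>\<nu>) + q * (\<integral>x. (f x)\<^sup>2 * ln ((f x)\<^sup>2) \<partial>\<rho>)"
  shows "Ent \<mu> (\<lambda>x. (f x)\<^sup>2) \<le> p * Ent \<nu> (\<lambda>x. (f x)\<^sup>2) + q * Ent \<rho> (\<lambda>x. (f x)\<^sup>2)
    + p * q * log_quot p q * (Var \<nu> f + Var \<rho> f + ((\<integral>x. f x \<partial>\<nu>) - (\<integral>x. f x \<partial>\<rho>))\<^sup>2)"
proof -
  let ?x = "\<integral>x. (f x)\<^sup>2 \<partial>\<nu>" and ?y = "\<integral>x. (f x)\<^sup>2 \<partial>\<rho>"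
  have nonneg: "?x \<ge> 0" "?y \<ge> 0" by simp_all
  have "Ent \<mu> (\<lambda>x. (f x)\<^sup>2) = p * Ent \<nu> (\<lambda>x. (f x)\<^sup>2) + q * Ent \<rho> (\<lambda>x. (f x)\<^sup>2)
      + (p * (?x * ln ?x) + q * (?y * ln ?y) - (p * ?x + q * ?y) * ln (p * ?x + q * ?y))"
    unfolding Ent_def mix by (simp add: algebra_simps)
  also have "\<dots> \<le> p * Ent \<nu> (\<lambda>x. (f x)\<^sup>2) + q * Ent \<rho> (\<lambda>x. (f x)\<^sup>2)
      + p * q * log_quot p q * (sqrt ?x - sqrt ?y)\<^sup>2"
    using two_point_log_sobolev[OF pq, of "sqrt ?x" "sqrt ?y"] nonneg by simp
  also have "\<dots> \<le> p * Ent \<nu> (\<lambda>x. (f x)\<^sup>2) + q * Ent \<rho> (\<lambda>x. (f x)\<^sup>2)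
      + p * q * log_quot p q * (Var \<nu> f + Var \<rho> f + ((\<integral>x. f x \<partial>\<nu>) - (\<integral>x. f x \<partial>\<rho>))\<^sup>2)"
    using pq log_quot_pos[OF pq(1,2)]
    by (intro add_left_mono mult_left_mono sqrt_second_moments_dist_le[OF \<nu> \<rho>]) auto
  finally show ?thesis .
qed

section \<open>Integration against bulk and surface measures\<close>

lemma sets_bulk_surface [simp]: "sets (bulk_surface \<alpha> vol \<beta> \<sigma>) = sets vol"
  by (simp add: bulk_surface_def sets.space_closed sets.sigma_sets_eq)

lemma space_bulk_surface [simp]: "space (bulk_surface \<alpha> vol \<beta> \<sigma>) = space vol"
  by (simp add: bulk_surface_def sets.space_closed)

lemma emeasure_bulk_surface:
  assumes "(\<lambda>x. x) \<in> \<sigma> \<rightarrow>\<^sub>M vol" and "E \<in> sets vol"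
  shows "emeasure (bulk_surface \<alpha> vol \<beta> \<sigma>) E =
    emeasure (weighted \<alpha> vol) E + emeasure (weighted \<beta> \<sigma>) (E \<inter> space \<sigma>)"
proof (rule emeasure_measure_of[OF bulk_surface_def])
  have meas: "F \<inter> space \<sigma> \<in> sets \<sigma>" if "F \<in> sets vol" for F
    using measurable_sets[OF assms(1) that] by (simp add: vimage_def Int_def)
  show "countably_additive (sets (bulk_surface \<alpha> vol \<beta> \<sigma>))
    (\<lambda>E. emeasure (weighted \<alpha> vol) E + emeasure (weighted \<beta> \<sigma>) (E \<inter> space \<sigma>))"
  proof (rule countably_additiveI)
    fix F :: "nat \<Rightarrow> 'a set"
    assume F: "range F \<subseteq> sets (bulk_surface \<alpha> vol \<beta> \<sigma>)" "disjoint_family F"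
    have "(\<Sum>i. emeasure (weighted \<alpha> vol) (F i) + emeasure (weighted \<beta> \<sigma>) (F i \<inter> space \<sigma>))
        = (\<Sum>i. emeasure (weighted \<alpha> vol) (F i)) + (\<Sum>i. emeasure (weighted \<beta> \<sigma>) (F i \<inter> space \<sigma>))"
      by (rule suminf_add[symmetric]) auto
    also have "(\<Sum>i. emeasure (weighted \<alpha> vol) (F i)) = emeasure (weighted \<alpha> vol) (\<Union>i. F i)"
      using F by (intro suminf_emeasure) (auto simp: weighted_def)
    also have "(\<Sum>i. emeasure (weighted \<beta> \<sigma>) (F i \<inter> space \<sigma>))
        = emeasure (weighted \<beta> \<sigma>) (\<Union>i. F i \<inter> space \<sigma>)"
      using F meas by (intro suminf_emeasure) (auto simp: weighted_def disjoint_family_on_def)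
    finally show "(\<Sum>i. emeasure (weighted \<alpha> vol) (F i) + emeasure (weighted \<beta> \<sigma>) (F i \<inter> space \<sigma>))
      = emeasure (weighted \<alpha> vol) (\<Union>(range F)) + emeasure (weighted \<beta> \<sigma>) (\<Union>(range F) \<inter> space \<sigma>)"
      by (simp add: Int_UN_distrib2)
  qed
qed (use assms in \<open>auto simp: positive_def sets.space_closed\<close>)

lemma measurable_weighted [simp]: "measurable (weighted w \<nu>) N = measurable \<nu> N"
  by (rule measurable_cong_sets) (simp_all add: weighted_def)

lemma measurable_bulk_surface [simp]: "measurable (bulk_surface \<alpha> vol \<beta> \<sigma>) N = measurable vol N"
  by (rule measurable_cong_sets) simp_all

text \<open>Only the surface part is integrated over a measure on a smaller space; measurability of the
  inclusion allows functions on the bulk to be integrated there.\<close>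

lemma nn_integral_bulk_surface:
  assumes id: "(\<lambda>x. x) \<in> \<sigma> \<rightarrow>\<^sub>M vol" and "h \<in> borel_measurable vol"
  shows "(\<integral>\<^sup>+x. h x \<partial>bulk_surface \<alpha> vol \<beta> \<sigma>) =
    (\<integral>\<^sup>+x. h x \<partial>weighted \<alpha> vol) + (\<integral>\<^sup>+x. h x \<partial>weighted \<beta> \<sigma>)"
  using assms(2)
proof (induction h rule: borel_measurable_induct)
  have space: "space \<sigma> \<subseteq> space vol" using measurable_space[OF id] by auto
  {
    case (cong f g)
    have "(\<integral>\<^sup>+x. f x \<partial>N) = (\<integral>\<^sup>+x. g x \<partial>N)" if "space N \<subseteq> space vol" for N
      using cong.hyps(3) that by (intro nn_integral_cong) auto
    from this[of "bulk_surface \<alpha> vol \<beta> \<sigma>"] this[of "weighted \<alpha> vol"] this[of "weighted \<beta> \<sigma>"]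
    show ?case
      using cong.IH space by (simp add: weighted_def)
  next
    case (set E)
    have "(\<integral>\<^sup>+x. indicator E x \<partial>weighted \<beta> \<sigma>) = (\<integral>\<^sup>+x. indicator (E \<inter> space \<sigma>) x \<partial>weighted \<beta> \<sigma>)"
      by (intro nn_integral_cong) (auto simp: weighted_def split: split_indicator)
    also have "\<dots> = emeasure (weighted \<beta> \<sigma>) (E \<inter> space \<sigma>)"
      using measurable_sets[OF id set]
      by (intro nn_integral_indicator) (simp add: vimage_def Int_def weighted_def)
    finally show ?case
      using set emeasure_bulk_surface[OF id set] by (simp add: weighted_def)
  next
    case (mult u c)
    have "u \<in> borel_measurable \<sigma>"
      using measurable_compose[OF id mult.hyps(2)] .
    with mult.hyps(2) have "(\<integral>\<^sup>+x. c * u x \<partial>N) = c * (\<integral>\<^sup>+x. u x \<partial>N)"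
      if "N \<in> {bulk_surface \<alpha> vol \<beta> \<sigma>, weighted \<alpha> vol, weighted \<beta> \<sigma>}" for N
      using that by (intro nn_integral_cmult) auto
    then show ?case
      by (simp only: insert_iff mult.IH distrib_left simp_thms)
  next
    case (add u v)
    have "u \<in> borel_measurable \<sigma>" "v \<in> borel_measurable \<sigma>"
      using measurable_compose[OF id add.hyps(1)] measurable_compose[OF id add.hyps(3)] by auto
    with add.hyps(1,3) have "(\<integral>\<^sup>+x. v x + u x \<partial>N) = (\<integral>\<^sup>+x. v x \<partial>N) + (\<integral>\<^sup>+x. u x \<partial>N)"
      if "N \<in> {bulk_surface \<alpha> vol \<beta> \<sigma>, weighted \<alpha> vol, weighted \<beta> \<sigma>}" for N
      using that by (intro nn_integral_add) auto
    then show ?case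
      by (simp only: insert_iff add.IH ac_simps simp_thms)
  next
    case (seq U)
    have meas: "U i \<in> borel_measurable \<sigma>" for i
      using measurable_compose[OF id, of "U i"] seq.hyps(1) by simp
    have Sup: "(\<integral>\<^sup>+x. (SUP i. U i) x \<partial>N) = (SUP i. \<integral>\<^sup>+x. U i x \<partial>N)"
      if "\<And>i. U i \<in> borel_measurable N" for N
      unfolding SUP_apply using seq.hyps(3) that by (rule nn_integral_monotone_convergence_SUP)
    have inc: "incseq (\<lambda>i. \<integral>\<^sup>+x. U i x \<partial>N)" for N
      using seq.hyps(3) by (auto simp: incseq_def le_fun_def intro!: nn_integral_mono)
    show ?case
      using seq.hyps(1) seq.IH meas
      by (simp only: Sup measurable_weighted measurable_bulk_surface ennreal_SUP_add[OF inc inc])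
  }
qed

lemma integral_bulk_surface:
  fixes h :: "'a \<Rightarrow> real"
  assumes id: "(\<lambda>x. x) \<in> \<sigma> \<rightarrow>\<^sub>M vol"
    and bulk: "integrable (weighted \<alpha> vol) h" and surf: "integrable (weighted \<beta> \<sigma>) h"
  shows "(\<integral>x. h x \<partial>bulk_surface \<alpha> vol \<beta> \<sigma>) =
    (\<integral>x. h x \<partial>weighted \<alpha> vol) + (\<integral>x. h x \<partial>weighted \<beta> \<sigma>)"
proof -
  have h [measurable]: "h \<in> borel_measurable vol"
    using borel_measurable_integrable[OF bulk] by simp
  note nn = nn_integral_bulk_surface[OF id, of _ \<alpha> \<beta>]
  have "integrable (bulk_surface \<alpha> vol \<beta> \<sigma>) h"
    using bulk surf by (simp add: integrable_iff_bounded nn)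
  then show ?thesis
    using bulk surf by (simp add: real_lebesgue_integral_def nn enn2real_plus real_integrable_def less_top)
qed

lemma emeasure_weighted_space:
  assumes "integrable \<nu> w" and "AE x in \<nu>. w x \<ge> 0"
  shows "emeasure (weighted w \<nu>) (space \<nu>) = ennreal (\<integral>x. w x \<partial>\<nu>)"
proof -
  have "emeasure (weighted w \<nu>) (space \<nu>) = (\<integral>\<^sup>+x. ennreal (w x) \<partial>\<nu>)"
    using assms by (auto simp: weighted_def emeasure_density intro!: nn_integral_cong)
  then show ?thesis using nn_integral_eq_integral[OF assms] by simp
qed

lemma prob_space_weighted:
  assumes pos: "AE x in \<nu>. w x > 0" and C: "C = (\<integral>x. w x \<partial>\<nu>)" "C > 0"
  shows "prob_space (weighted (\<lambda>x. w x / C) \<nu>)" and "finite_measure (weighted w \<nu>)"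
proof -
  have int: "integrable \<nu> w"
    using C not_integrable_integral_eq by fastforce
  have nonneg: "AE x in \<nu>. w x \<ge> 0" "AE x in \<nu>. w x / C \<ge> 0"
    using pos C by (auto elim!: eventually_mono)
  show "prob_space (weighted (\<lambda>x. w x / C) \<nu>)"
    using emeasure_weighted_space[OF _ nonneg(2)] int C
    by (intro prob_spaceI) (simp add: weighted_def)
  show "finite_measure (weighted w \<nu>)"
    using emeasure_weighted_space[OF int nonneg(1)]
    by (intro finite_measureI) (simp add: weighted_def)
qed

text \<open>The function \<open>g\<close> is arbitrary so that it can be a squared gradient length, whose
  measurability would need a separate argument. If \<open>g\<close> is not measurable, both integrals are
  \<open>0\<close>.\<close>

lemma integral_weighted_scale:
  fixes g :: "'a \<Rightarrow> real"
  assumes "C > 0" and [measurable]: "w \<in> borel_measurable \<nu>" and "AE x in \<nu>. w x \<ge> 0"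
  shows "(\<integral>x. g x \<partial>weighted w \<nu>) = C * (\<integral>x. g x \<partial>weighted (\<lambda>x. w x / C) \<nu>)"
proof (cases "g \<in> borel_measurable \<nu>")
  case True
  have "AE x in \<nu>. w x / C \<ge> 0" using assms by auto
  then show ?thesis using True assms
    by (simp add: weighted_def integral_density)
next
  case False
  then have "\<not> integrable (weighted v \<nu>) g" for v
    using borel_measurable_integrable[of "weighted v \<nu>" g] by auto
  then show ?thesis by (simp add: not_integrable_integral_eq)
qed

lemma continuous_on_imp_borel_measurable:
  assumes "sets \<nu> = sets (restrict_space borel S)" and "continuous_on S f"
  shows "f \<in> borel_measurable \<nu>"
  unfolding measurable_cong_sets[OF assms(1) refl]
  using assms(2) by (rule borel_measurable_continuous_on_restrict)

text \<open>From \<open>1 - 1 / t \<le> ln t \<le> t - 1\<close>; a crude bound that makes \<open>t ln t\<close> bounded for bounded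
  \<open>t\<close>.\<close>

lemma abs_mult_ln_le:
  fixes t :: real
  assumes "0 \<le> t"
  shows "\<bar>t * ln t\<bar> \<le> t\<^sup>2 + 1"
proof (cases "t = 0")
  case False
  then have t: "t > 0" using assms by simp
  have "t * ln t \<le> t * (t - 1)"
    using t by (intro mult_left_mono ln_le_minus_one) auto
  moreover have "t * (1 - 1 / t) \<le> t * ln t"
    using t ln_le_minus_one[of "1 / t"] by (intro mult_left_mono) (auto simp: ln_div)
  moreover have "t * (1 - 1 / t) = t - 1"
    using t by (simp add: algebra_simps)
  moreover have "t * (t - 1) = t\<^sup>2 - t"
    by (simp add: power2_eq_square algebra_simps)
  moreover have "t\<^sup>2 \<ge> 0" by simp
  ultimately show ?thesis using t unfolding abs_le_iff by linarith
qed simp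

lemma integrable_entropy_integrands:
  fixes f :: "'a \<Rightarrow> real"
  assumes "finite_measure \<nu>" and [measurable]: "f \<in> borel_measurable \<nu>"
    and bound: "\<And>x. x \<in> space \<nu> \<Longrightarrow> \<bar>f x\<bar> \<le> C"
  shows "integrable \<nu> f" "integrable \<nu> (\<lambda>x. (f x)\<^sup>2)"
    and "integrable \<nu> (\<lambda>x. (f x)\<^sup>2 * ln ((f x)\<^sup>2))"
proof -
  interpret finite_measure \<nu> by fact
  have sq: "(f x)\<^sup>2 \<le> C\<^sup>2" if "x \<in> space \<nu>" for x
    using power_mono[OF bound[OF that], of 2] by simp
  show "integrable \<nu> f"
    using bound by (intro integrable_const_bound[of _ C]) auto
  show "integrable \<nu> (\<lambda>x. (f x)\<^sup>2)"
    using sq by (intro integrable_const_bound[of _ "C\<^sup>2"]) auto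
  have "\<bar>(f x)\<^sup>2 * ln ((f x)\<^sup>2)\<bar> \<le> (C\<^sup>2)\<^sup>2 + 1" if "x \<in> space \<nu>" for x
    using abs_mult_ln_le[of "(f x)\<^sup>2"] power_mono[OF sq[OF that], of 2] by simp
  then show "integrable \<nu> (\<lambda>x. (f x)\<^sup>2 * ln ((f x)\<^sup>2))"
    by (intro integrable_const_bound[of _ "(C\<^sup>2)\<^sup>2 + 1"]) auto
qed

section \<open>Differentiable functions and gradients on a manifold with boundary\<close>

lemma Ck_on_1_compose_Pair:
  fixes F :: "real \<times> 'b::euclidean_space \<Rightarrow> real"
  assumes "Ck_on 1 W F"
  shows "Ck_on 1 {y. (0, y) \<in> W} (\<lambda>y. F (0, y))"
proof -
  have F: "F differentiable (at x)" "continuous_on W (\<lambda>x. frechet_derivative F (at x) v)"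
    if "x \<in> W" for x v
    using assms that by (auto simp del: split_paired_All)
  have pair: "((\<lambda>y::'b. (0::real, y)) has_derivative (\<lambda>w. (0, w))) (at y)" for y
    by (auto intro!: derivative_eq_intros)
  have deriv: "((\<lambda>y. F (0, y)) has_derivative (\<lambda>w. frechet_derivative F (at (0, y)) (0, w))) (at y)"
    if "(0, y) \<in> W" for y
    using has_derivative_compose[OF pair F(1)[OF that, unfolded frechet_derivative_works]] .
  have cont: "continuous_on {y. (0, y) \<in> W} (\<lambda>y. frechet_derivative F (at (0, y)) (0, w))" for w
  proof (cases "{y. (0::real, y) \<in> W} = {}")
    case False
    then obtain y where "(0, y) \<in> W" by blast
    show ?thesis
      by (rule continuous_on_compose2[OF F(2)[OF \<open>(0, y) \<in> W\<close>]]) (auto intro!: continuous_intros)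
  qed simp
  have "continuous_on {y. (0, y) \<in> W} (\<lambda>y. frechet_derivative (\<lambda>y. F (0, y)) (at y) w)" for w
    by (rule continuous_on_eq[OF cont]) (simp add: frechet_derivative_at[OF deriv, symmetric])
  then show ?thesis
    using deriv by (auto simp: differentiable_def)
qed

lemma carrier_bdry_subset: "carrier (bdry M) \<subseteq> carrier M"
  by (auto simp: carrier_def bdry_def bchart_def)

lemma cinv_cmap:
  assumes "smooth_atlas H M" "c \<in> M" "p \<in> cdom c"
  shows "cinv c (cmap c p) = p"
  using assms by (auto simp: smooth_atlas_def homeomorphism_def)

lemma crange_bchart: "crange (bchart c) = {y. (0, y) \<in> crange c}"
proof (intro subset_antisym subsetI)
  fix y assume "y \<in> crange (bchart c)"
  then obtain p where "p \<in> cdom c" "fst (cmap c p) = 0" "y = snd (cmap c p)"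
    by (auto simp: crange_def bchart_def)
  then have "cmap c p = (0, y)" by (simp add: prod_eq_iff)
  then show "y \<in> {y. (0, y) \<in> crange c}"
    using \<open>p \<in> cdom c\<close> by (force simp: crange_def)
next
  fix y assume "y \<in> {y. (0, y) \<in> crange c}"
  then obtain p where "p \<in> cdom c" "cmap c p = (0, y)"
    by (auto simp: crange_def)
  then show "y \<in> crange (bchart c)"
    by (auto simp: crange_def bchart_def intro!: image_eqI[of _ _ p])
qed

lemma cinv_bchart:
  assumes "smooth_atlas H M" "c \<in> M" "y \<in> crange (bchart c)"
  shows "cinv (bchart c) y = cinv c (0, y)"
proof -
  let ?p = "cinv (bchart c) y"
  have "?p \<in> cdom (bchart c)" "cmap (bchart c) ?p = y"
    using assms(3) by (auto simp: cinv_def crange_def inv_into_into f_inv_into_f)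
  then have "?p \<in> cdom c" "cmap c ?p = (0, y)"
    by (auto simp: bchart_def prod_eq_iff)
  then show ?thesis
    using cinv_cmap[OF assms(1,2)] by metis
qed

text \<open>In a boundary chart the local \<open>C\<^sup>1\<close> extensions of \<open>f\<close> are restricted to the hyperplane of
  vanishing first coordinate; hence the inequalities on \<open>bdry M\<close> apply to every \<open>C\<^sup>1\<close> function
  on \<open>M\<close>.\<close>

lemma C1_subset_C1_bdry:
  assumes atlas: "smooth_atlas H M"
  shows "C1 M \<subseteq> C1 (bdry M)"
proof
  fix f assume f: "f \<in> C1 M"
  have "C1_within (crange (bchart c)) (f \<circ> cinv (bchart c))" if c: "c \<in> M" for c
    unfolding C1_within_def
  proof
    fix y assume y: "y \<in> crange (bchart c)"
    then have "(0, y) \<in> crange c" by (simp add: crange_bchart)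
    moreover have "C1_within (crange c) (f \<circ> cinv c)"
      using f c by (simp add: C1_def)
    ultimately obtain W F where W: "open W" "(0, y) \<in> W" "Ck_on 1 W F"
      "\<forall>z\<in>crange c \<inter> W. F z = (f \<circ> cinv c) z"
      unfolding C1_within_def by blast
    let ?W = "{y. (0, y) \<in> W}"
    have "open ?W"
      using open_vimage[OF W(1), of "\<lambda>y. (0, y)"] by (simp add: vimage_def continuous_intros)
    moreover have "\<forall>z\<in>crange (bchart c) \<inter> ?W. F (0, z) = (f \<circ> cinv (bchart c)) z"
      using W(4) cinv_bchart[OF atlas c] by (auto simp: crange_bchart)
    ultimately show "\<exists>W F. open W \<and> y \<in> W \<and> Ck_on 1 W F \<and>
        (\<forall>z\<in>crange (bchart c) \<inter> W. F z = (f \<circ> cinv (bchart c)) z)"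
      using W(2) Ck_on_1_compose_Pair[OF W(3)] by blast
  qed
  then show "f \<in> C1 (bdry M)"
    by (simp add: C1_def bdry_def)
qed

lemma C1_within_imp_continuous_on:
  assumes "C1_within S f"
  shows "continuous_on S f"
  unfolding continuous_on_eq_continuous_within
proof
  fix x assume "x \<in> S"
  then obtain W F where W: "open W" "x \<in> W" "Ck_on 1 W F" "\<forall>y\<in>S \<inter> W. F y = f y"
    using assms unfolding C1_within_def by blast
  have "F differentiable (at x)"
    using W(2,3) by simp
  then have "continuous (at x within S) F"
    by (intro continuous_at_imp_continuous_within[OF differentiable_imp_continuous_within])
  then show "continuous (at x within S) f"
    unfolding continuous_within
  proof (rule Lim_transform_eventually[where f = F, THEN tendsto_eq_rhs])
    show "\<forall>\<^sub>F y in at x within S. F y = f y"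
      using W by (auto simp: eventually_at_topological)
    show "F x = f x" using W \<open>x \<in> S\<close> by simp
  qed
qed

lemma C1_imp_continuous_on:
  assumes atlas: "smooth_atlas H M" and f: "f \<in> C1 M"
  shows "continuous_on (carrier M) f"
  unfolding continuous_on_eq_continuous_within
proof
  fix p assume "p \<in> carrier M"
  then obtain c where c: "c \<in> M" "p \<in> cdom c" by (auto simp: carrier_def)
  have "continuous_on (crange c) (f \<circ> cinv c)"
    using f c by (intro C1_within_imp_continuous_on) (simp add: C1_def)
  moreover have "continuous_on (cdom c) (cmap c)" "openin (top_of_set (carrier M)) (cdom c)"
    using atlas c by (auto simp: smooth_atlas_def homeomorphism_def)
  ultimately have "continuous_on (cdom c) ((f \<circ> cinv c) \<circ> cmap c)"
    by (intro continuous_on_compose[of _ "cmap c"]) (simp_all only: crange_def)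
  then have "continuous_on (cdom c) f"
    by (rule continuous_on_eq) (simp add: cinv_cmap[OF atlas c(1)])
  then have "continuous (at p within cdom c) f"
    using c by (simp add: continuous_on_eq_continuous_within)
  moreover obtain T where "open T" "cdom c = carrier M \<inter> T"
    using \<open>openin (top_of_set (carrier M)) (cdom c)\<close> by (auto simp: openin_open)
  then have "at p within cdom c = at p within carrier M"
    using c by (intro at_within_nhd[of p T]) auto
  ultimately show "continuous (at p within carrier M) f"
    by (simp add: continuous_within)
qed

lemma grad_sq_nonneg:
  assumes "\<And>c v. c \<in> M \<Longrightarrow> p \<in> cdom c \<Longrightarrow> cmet c p v v \<ge> 0" and "p \<in> carrier M"
  shows "grad_sq M f p \<ge> 0"
proof -
  let ?c = "SOME c. c \<in> M \<and> p \<in> cdom c"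
  have "?c \<in> M \<and> p \<in> cdom ?c"
    by (rule someI_ex) (use assms(2) in \<open>auto simp: carrier_def\<close>)
  then show ?thesis using assms(1) by (simp add: grad_sq_def Let_def)
qed

lemma cmet_nonneg:
  assumes "riemannian_metric M" "c \<in> M" "p \<in> cdom c"
  shows "cmet c p v v \<ge> 0"
proof (cases "v = 0")
  case True
  have "bilinear (cmet c p)" using assms unfolding riemannian_metric_def by blast
  then show ?thesis using True by (simp add: bilinear_lzero)
next
  case False
  then show ?thesis using assms unfolding riemannian_metric_def by (blast intro: less_imp_le)
qed

text \<open>Pointwise nonnegativity gives the claim whether or not the integral converges, because a
  function that is not integrable has integral \<open>0\<close>.\<close>

lemma integral_grad_sq_nonneg:
  assumes "riemannian_metric M" and "space \<nu> \<subseteq> carrier M"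
  shows "(\<integral>x. grad_sq M f x \<partial>\<nu>) \<ge> 0"
proof (intro integral_nonneg_AE AE_I2)
  fix p assume "p \<in> space \<nu>"
  then show "grad_sq M f p \<ge> 0"
    using assms cmet_nonneg[OF assms(1)] by (intro grad_sq_nonneg) auto
qed

lemma integral_grad_sq_bdry_nonneg:
  assumes "riemannian_metric M" and "space \<nu> \<subseteq> carrier (bdry M)"
  shows "(\<integral>x. grad_sq (bdry M) f x \<partial>\<nu>) \<ge> 0"
proof (intro integral_nonneg_AE AE_I2)
  fix p assume "p \<in> space \<nu>"
  moreover have "cmet c p v v \<ge> 0" if "c \<in> bdry M" "p \<in> cdom c" for c v
  proof -
    obtain c' where "c' \<in> M" "c = bchart c'" using \<open>c \<in> bdry M\<close> by (auto simp: bdry_def)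
    then show ?thesis
      using \<open>p \<in> cdom c\<close> cmet_nonneg[OF assms(1), of c' p "(0, v)"] by (simp add: bchart_def)
  qed
  ultimately show "grad_sq (bdry M) f p \<ge> 0"
    using assms(2) by (intro grad_sq_nonneg) auto
qed

lemma sets_surface_measure:
  "sets (surface_measure M) = sets (restrict_space borel (carrier (bdry M)))"
proof -
  let ?R = "restrict_space borel (carrier (bdry M))"
  have "space ?R = carrier (bdry M)" by (simp add: space_restrict_space)
  then have "sets (surface_measure M) = sigma_sets (space ?R) (sets ?R)"
    using sets.space_closed[of ?R] unfolding surface_measure_def by (metis sets_measure_of)
  then show ?thesis by (simp only: sets.sigma_sets_eq)
qed

lemma space_surface_measure: "space (surface_measure M) = carrier (bdry M)"
  using sets_eq_imp_space_eq[OF sets_surface_measure[of M]] by (simp only: space_restrict_space) simp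

section \<open>Optimal constants and the mixed inequality\<close>

text \<open>The infimum is itself admissible because each \<open>D f\<close> is nonnegative: for \<open>D f > 0\<close> every
  admissible constant is at least \<open>V f / D f\<close>, and for \<open>D f = 0\<close> one admissible constant
  suffices.\<close>

lemma optimal_constant_attained:
  fixes V D :: "'f \<Rightarrow> real"
  assumes fin: "\<bar>INF c\<in>{c::real. \<forall>f\<in>F. V f \<le> c * D f}. ereal c\<bar> \<noteq> \<infinity>"
    and f: "f \<in> F" "D f \<ge> 0"
  shows "V f \<le> real_of_ereal (INF c\<in>{c::real. \<forall>f\<in>F. V f \<le> c * D f}. ereal c) * D f"
proof -
  let ?S = "{c::real. \<forall>f\<in>F. V f \<le> c * D f}"
  have "?S \<noteq> {}"
  proof
    assume "?S = {}"
    then have "(INF c\<in>?S. ereal c) = \<infinity>" by (simp only:) (simp add: top_ereal_def)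
    then show False using fin by simp
  qed
  then obtain c where c: "c \<in> ?S" by blast
  show ?thesis
  proof (cases "D f = 0")
    case True
    then show ?thesis using c f by fastforce
  next
    case False
    then have D: "D f > 0" using f by simp
    have "ereal (V f / D f) \<le> (INF c\<in>?S. ereal c)"
      using f D by (intro INF_greatest) (auto simp: divide_le_eq)
    then have "ereal (V f / D f) \<le> ereal (real_of_ereal (INF c\<in>?S. ereal c))"
      using fin by (simp add: ereal_real')
    then show ?thesis using D by (simp add: divide_le_eq)
  qed
qed

text \<open>Collecting the coefficients of \<open>A a\<close> and of \<open>B b\<close> gives exactly the two entries of the
  maximum.\<close>

lemma energy_combination_le_max:
  fixes a b :: real
  assumes "A > 0" "B > 0" "a \<ge> 0" "b \<ge> 0"
  shows "A * (L\<^sub>1 * a) + B * (s * (L * a) + (1 - s) * (L\<^sub>2 * b))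
      + A * B * r * (C\<^sub>1 * a + (t * (K * a) + (1 - t) * (C\<^sub>2 * b)) + (K\<^sub>1 * a + K\<^sub>2 * b))
    \<le> max (L\<^sub>1 + s * L * (B / A) + B * r * (C\<^sub>1 + t * K + K\<^sub>1))
          ((1 - s) * L\<^sub>2 + A * r * ((1 - t) * C\<^sub>2 + K\<^sub>2)) * (A * a + B * b)"
    (is "_ \<le> max ?X ?Y * _")
proof -
  have "A * (L\<^sub>1 * a) + B * (s * (L * a) + (1 - s) * (L\<^sub>2 * b))
      + A * B * r * (C\<^sub>1 * a + (t * (K * a) + (1 - t) * (C\<^sub>2 * b)) + (K\<^sub>1 * a + K\<^sub>2 * b))
    = ?X * (A * a) + ?Y * (B * b)"
    using assms by (simp add: field_simps)
  also have "\<dots> \<le> max ?X ?Y * (A * a) + max ?X ?Y * (B * b)"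
    using assms by (intro add_mono mult_right_mono) auto
  finally show ?thesis by (simp add: distrib_left)
qed

lemma convex_combination_le:
  fixes x u v s :: real
  assumes "0 \<le> s" "s \<le> 1" "x \<le> u" "x \<le> v"
  shows "x \<le> s * u + (1 - s) * v"
proof -
  have "s * x + (1 - s) * x \<le> s * u + (1 - s) * v"
    using assms by (intro add_mono mult_left_mono) auto
  then show ?thesis by (simp add: algebra_simps)
qed

text \<open>The infimum of a set of reals that is not bounded below is unrelated to its infimum in the
  extended reals, hence the boundedness assumption.\<close>

lemma le_ereal_INF:
  assumes "S \<noteq> {}" "bdd_below (g ` S)" "\<And>x. x \<in> S \<Longrightarrow> m \<le> ereal (g x)"
  shows "m \<le> ereal (INF x\<in>S. g x)"
  using assms by (subst ereal_Inf') (auto intro: INF_greatest)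

lemma Var_le_poincare_const:
  assumes "\<bar>poincare_const M \<nu>\<bar> \<noteq> \<infinity>" "f \<in> C1 M" "(\<integral>x. grad_sq M f x \<partial>\<nu>) \<ge> 0"
  shows "Var \<nu> f \<le> real_of_ereal (poincare_const M \<nu>) * (\<integral>x. grad_sq M f x \<partial>\<nu>)"
  using assms unfolding poincare_const_def
  by (rule optimal_constant_attained[of "C1 M" "Var \<nu>" "\<lambda>f. \<integral>x. grad_sq M f x \<partial>\<nu>"])

lemma Ent_le_log_sobolev_const:
  assumes "\<bar>log_sobolev_const M \<nu>\<bar> \<noteq> \<infinity>" "f \<in> C1 M" "(\<integral>x. grad_sq M f x \<partial>\<nu>) \<ge> 0"
  shows "Ent \<nu> (\<lambda>x. (f x)\<^sup>2) \<le> real_of_ereal (log_sobolev_const M \<nu>) * (\<integral>x. grad_sq M f x \<partial>\<nu>)"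
  using assms unfolding log_sobolev_const_def
  by (rule optimal_constant_attained[of "C1 M" "\<lambda>f. Ent \<nu> (\<lambda>x. (f x)\<^sup>2)"
      "\<lambda>f. \<integral>x. grad_sq M f x \<partial>\<nu>"])

theorem proposition3p1:
  fixes M :: "('a::t2_space, real \<times> 'b::euclidean_space) rchart set"
    and vol \<sigma> vol\<^sub>\<alpha> \<sigma>\<^sub>\<beta> :: "'a measure"
    and \<alpha> \<beta> :: "'a \<Rightarrow> real"
    and A B d K_bd L_bd K1 K2 :: real
  assumes "riemannian_manifold half_space M"
    and "compact (carrier M)" and "connected (carrier M)"
    and "connected (carrier (bdry M))"
    and "riemannian_volume M vol"
    and \<sigma>_def: "\<sigma> = surface_measure M"
    and d_def: "d = real (DIM(real \<times> 'b))"
    and A_def: "A = (\<integral>x. \<alpha> x \<partial>vol)"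
    and B_def: "B = (\<integral>x. \<beta> x \<partial>\<sigma>)"
    and vol\<^sub>\<alpha>_def: "vol\<^sub>\<alpha> = weighted (\<lambda>x. \<alpha> x / A) vol"
    and \<sigma>\<^sub>\<beta>_def: "\<sigma>\<^sub>\<beta> = weighted (\<lambda>x. \<beta> x / B) \<sigma>"
    \<comment> \<open>standing assumptions\<close>
    and "prob_space (bulk_surface \<alpha> vol \<beta> \<sigma>)"
    and "0 < A" and "A < 1" and "0 < B" and "B < 1" and "A + B = 1"
    and "continuous_on (carrier M) \<alpha>" and "continuous_on (carrier M) \<beta>"
    and "AE x in vol. \<alpha> x > 0" and "AE x in \<sigma>. \<beta> x > 0"
    and "(\<lambda>x. sqrt (\<alpha> x)) \<in> W12 M vol"
    and "(\<lambda>x. sqrt (\<beta> x)) \<in> W12 (bdry M) \<sigma>"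
    and "\<bar>poincare_const M vol\<^sub>\<alpha>\<bar> \<noteq> \<infinity>" and "\<bar>log_sobolev_const M vol\<^sub>\<alpha>\<bar> \<noteq> \<infinity>"
    and "\<bar>poincare_const (bdry M) \<sigma>\<^sub>\<beta>\<bar> \<noteq> \<infinity>" and "\<bar>log_sobolev_const (bdry M) \<sigma>\<^sub>\<beta>\<bar> \<noteq> \<infinity>"
    and "W12_compact_op M (weighted \<alpha> vol) 2 (weighted \<alpha> vol) (\<lambda>f. f)"
    and "\<And>p. 2 \<le> p \<Longrightarrow> (d > 2 \<Longrightarrow> p \<le> (2 * d - 2) / (d - 2)) \<Longrightarrow>
           W12_bounded_op M (weighted \<alpha> vol) p (weighted \<beta> vol) (\<lambda>f. f)"
    and "W12_compact_op (bdry M) (weighted \<beta> \<sigma>) 2 (weighted \<beta> \<sigma>) (\<lambda>f. f)"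
    and "compact_trace M (weighted \<alpha> vol) (weighted \<beta> \<sigma>)"
    \<comment> \<open>hypotheses of the proposition\<close>
    and "\<And>f. f \<in> C1 M \<Longrightarrow> Var \<sigma>\<^sub>\<beta> f \<le> K_bd * (\<integral>x. grad_sq M f x \<partial>vol\<^sub>\<alpha>)"
    and "\<And>f. f \<in> C1 M \<Longrightarrow> Ent \<sigma>\<^sub>\<beta> (\<lambda>x. (f x)\<^sup>2) \<le> L_bd * (\<integral>x. grad_sq M f x \<partial>vol\<^sub>\<alpha>)"
    and "\<And>f. f \<in> C1 M \<Longrightarrow> ((\<integral>x. f x \<partial>vol\<^sub>\<alpha>) - (\<integral>x. f x \<partial>\<sigma>\<^sub>\<beta>))\<^sup>2 \<le>
           K1 * (\<integral>x. grad_sq M f x \<partial>vol\<^sub>\<alpha>) + K2 * (\<integral>x. grad_sq (bdry M) f x \<partial>\<sigma>\<^sub>\<beta>)"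
  shows "mixed_log_sobolev_const M \<alpha> vol \<beta> \<sigma> \<le>
    ereal (INF (s, t) \<in> {0..1} \<times> {0..1}.
      max (real_of_ereal (log_sobolev_const M vol\<^sub>\<alpha>) + s * L_bd * (B / A)
             + B * log_quot A B * (real_of_ereal (poincare_const M vol\<^sub>\<alpha>) + t * K_bd + K1))
          ((1 - s) * real_of_ereal (log_sobolev_const (bdry M) \<sigma>\<^sub>\<beta>)
             + A * log_quot A B * ((1 - t) * real_of_ereal (poincare_const (bdry M) \<sigma>\<^sub>\<beta>) + K2)))"
proof -
  let ?L\<^sub>1 = "real_of_ereal (log_sobolev_const M vol\<^sub>\<alpha>)"
    and ?L\<^sub>2 = "real_of_ereal (log_sobolev_const (bdry M) \<sigma>\<^sub>\<beta>)"
    and ?C\<^sub>1 = "real_of_ereal (poincare_const M vol\<^sub>\<alpha>)"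
    and ?C\<^sub>2 = "real_of_ereal (poincare_const (bdry M) \<sigma>\<^sub>\<beta>)"
  let ?bound = "\<lambda>s t. max (?L\<^sub>1 + s * L_bd * (B / A) + B * log_quot A B * (?C\<^sub>1 + t * K_bd + K1))
    ((1 - s) * ?L\<^sub>2 + A * log_quot A B * ((1 - t) * ?C\<^sub>2 + K2))"
  have atlas: "smooth_atlas half_space M" and metric: "riemannian_metric M"
    using \<open>riemannian_manifold half_space M\<close> by (auto simp: riemannian_manifold_def)
  have sets_vol: "sets vol = sets (restrict_space borel (carrier M))"
    using \<open>riemannian_volume M vol\<close> by (simp only: riemannian_volume_def)
  then have space_vol: "space vol = carrier M"
    using sets_eq_imp_space_eq[OF sets_vol] by (simp only: space_restrict_space) simp
  have sets_\<sigma>: "sets \<sigma> = sets (restrict_space borel (carrier (bdry M)))"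
    and space_\<sigma>: "space \<sigma> = carrier (bdry M)"
    unfolding \<sigma>_def by (rule sets_surface_measure space_surface_measure)+
  have id: "(\<lambda>x. x) \<in> \<sigma> \<rightarrow>\<^sub>M vol"
    unfolding measurable_cong_sets[OF sets_\<sigma> sets_vol]
    using carrier_bdry_subset[of M]
    by (intro measurable_restrict_space2 measurable_restrict_space1)
       (auto simp: space_restrict_space)
  have prob: "prob_space vol\<^sub>\<alpha>" "prob_space \<sigma>\<^sub>\<beta>"
    and fin: "finite_measure (weighted \<alpha> vol)" "finite_measure (weighted \<beta> \<sigma>)"
    unfolding vol\<^sub>\<alpha>_def \<sigma>\<^sub>\<beta>_def
    using prob_space_weighted[OF \<open>AE x in vol. \<alpha> x > 0\<close> A_def \<open>0 < A\<close>]
      prob_space_weighted[OF \<open>AE x in \<sigma>. \<beta> x > 0\<close> B_def \<open>0 < B\<close>] by blast+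
  have \<alpha>: "\<alpha> \<in> borel_measurable vol" and \<beta>: "\<beta> \<in> borel_measurable \<sigma>"
    using continuous_on_imp_borel_measurable[OF sets_vol \<open>continuous_on (carrier M) \<alpha>\<close>]
      continuous_on_imp_borel_measurable[OF sets_\<sigma>
        continuous_on_subset[OF \<open>continuous_on (carrier M) \<beta>\<close> carrier_bdry_subset]] .
  have scale_vol: "(\<integral>x. g x \<partial>weighted \<alpha> vol) = A * (\<integral>x. g x \<partial>vol\<^sub>\<alpha>)" for g :: "'a \<Rightarrow> real"
    unfolding vol\<^sub>\<alpha>_def
    by (rule integral_weighted_scale[OF \<open>0 < A\<close> \<alpha>]) (use \<open>AE x in vol. \<alpha> x > 0\<close> in auto)
  have scale_\<sigma>: "(\<integral>x. g x \<partial>weighted \<beta> \<sigma>) = B * (\<integral>x. g x \<partial>\<sigma>\<^sub>\<beta>)" for g :: "'a \<Rightarrow> real"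
    unfolding \<sigma>\<^sub>\<beta>_def
    by (rule integral_weighted_scale[OF \<open>0 < B\<close> \<beta>]) (use \<open>AE x in \<sigma>. \<beta> x > 0\<close> in auto)
  have sets_\<alpha>: "sets vol\<^sub>\<alpha> = sets vol" and sets_\<beta>: "sets \<sigma>\<^sub>\<beta> = sets \<sigma>"
    by (simp_all add: vol\<^sub>\<alpha>_def \<sigma>\<^sub>\<beta>_def weighted_def)
  have space_\<alpha>: "space vol\<^sub>\<alpha> = carrier M" and space_\<beta>: "space \<sigma>\<^sub>\<beta> = carrier (bdry M)"
    using sets_eq_imp_space_eq[OF sets_\<alpha>] sets_eq_imp_space_eq[OF sets_\<beta>] space_vol space_\<sigma> by auto
  have key: "Ent (bulk_surface \<alpha> vol \<beta> \<sigma>) (\<lambda>x. (f x)\<^sup>2) \<le> ?bound s t *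
      ((\<integral>x. grad_sq M f x \<partial>weighted \<alpha> vol) + (\<integral>x. grad_sq (bdry M) f x \<partial>weighted \<beta> \<sigma>))"
    if f: "f \<in> C1 M" and s: "0 \<le> s" "s \<le> 1" and t: "0 \<le> t" "t \<le> 1" for f s t
  proof -
    have f_bdry: "f \<in> C1 (bdry M)"
      using C1_subset_C1_bdry[OF atlas] f by blast
    have cont: "continuous_on (carrier M) f"
      by (rule C1_imp_continuous_on[OF atlas f])
    then have "bounded (f ` carrier M)"
      using \<open>compact (carrier M)\<close> by (intro compact_imp_bounded compact_continuous_image)
    then obtain c where c: "\<And>x. x \<in> carrier M \<Longrightarrow> \<bar>f x\<bar> \<le> c"
      by (auto simp: bounded_iff)
    have meas_vol: "f \<in> borel_measurable vol"
      by (rule continuous_on_imp_borel_measurable[OF sets_vol cont])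
    have meas_\<sigma>: "f \<in> borel_measurable \<sigma>"
      using measurable_compose[OF id meas_vol] by simp
    have space: "space (weighted \<alpha> vol) = carrier M" "space (weighted \<beta> \<sigma>) = carrier (bdry M)"
      by (simp_all add: weighted_def space_vol space_\<sigma>)
    have int: "integrable N f" "integrable N (\<lambda>x. (f x)\<^sup>2)" "integrable N (\<lambda>x. (f x)\<^sup>2 * ln ((f x)\<^sup>2))"
      if "N \<in> {weighted \<alpha> vol, weighted \<beta> \<sigma>, vol\<^sub>\<alpha>, \<sigma>\<^sub>\<beta>}" for N
    proof -
      have "finite_measure N"
        using that fin prob[THEN prob_space.finite_measure] by blast
      moreover have "f \<in> borel_measurable N"
        using that meas_vol meas_\<sigma> measurable_cong_sets[OF sets_\<alpha> refl] measurable_cong_sets[OF sets_\<beta> refl]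
        by auto
      moreover have "space N \<subseteq> carrier M"
        using that space space_\<alpha> space_\<beta> carrier_bdry_subset[of M] by blast
      ultimately show "integrable N f" "integrable N (\<lambda>x. (f x)\<^sup>2)"
          "integrable N (\<lambda>x. (f x)\<^sup>2 * ln ((f x)\<^sup>2))"
        using c by (auto intro!: integrable_entropy_integrands[of N f c])
    qed
    have mix: "(\<integral>x. h x \<partial>bulk_surface \<alpha> vol \<beta> \<sigma>) = A * (\<integral>x. h x \<partial>vol\<^sub>\<alpha>) + B * (\<integral>x. h x \<partial>\<sigma>\<^sub>\<beta>)"
      if "integrable (weighted \<alpha> vol) h" "integrable (weighted \<beta> \<sigma>) h" for h
      using integral_bulk_surface[OF id that] by (simp only: scale_vol scale_\<sigma>)
    define a where "a = (\<integral>x. grad_sq M f x \<partial>vol\<^sub>\<alpha>)"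
    define b where "b = (\<integral>x. grad_sq (bdry M) f x \<partial>\<sigma>\<^sub>\<beta>)"
    have a: "a \<ge> 0"
      unfolding a_def by (rule integral_grad_sq_nonneg[OF metric]) (simp add: space_\<alpha>)
    have b: "b \<ge> 0"
      unfolding b_def by (rule integral_grad_sq_bdry_nonneg[OF metric]) (simp add: space_\<beta>)
    have bulk: "Ent vol\<^sub>\<alpha> (\<lambda>x. (f x)\<^sup>2) \<le> ?L\<^sub>1 * a" "Var vol\<^sub>\<alpha> f \<le> ?C\<^sub>1 * a"
      using Ent_le_log_sobolev_const[OF \<open>\<bar>log_sobolev_const M vol\<^sub>\<alpha>\<bar> \<noteq> \<infinity>\<close> f]
        Var_le_poincare_const[OF \<open>\<bar>poincare_const M vol\<^sub>\<alpha>\<bar> \<noteq> \<infinity>\<close> f] a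
      by (simp_all add: a_def)
    have surf: "Ent \<sigma>\<^sub>\<beta> (\<lambda>x. (f x)\<^sup>2) \<le> ?L\<^sub>2 * b" "Var \<sigma>\<^sub>\<beta> f \<le> ?C\<^sub>2 * b"
      using Ent_le_log_sobolev_const[OF \<open>\<bar>log_sobolev_const (bdry M) \<sigma>\<^sub>\<beta>\<bar> \<noteq> \<infinity>\<close> f_bdry]
        Var_le_poincare_const[OF \<open>\<bar>poincare_const (bdry M) \<sigma>\<^sub>\<beta>\<bar> \<noteq> \<infinity>\<close> f_bdry] b
      by (simp_all add: b_def)
    have "Ent \<sigma>\<^sub>\<beta> (\<lambda>x. (f x)\<^sup>2) \<le> L_bd * a" "Var \<sigma>\<^sub>\<beta> f \<le> K_bd * a"
      and means: "((\<integral>x. f x \<partial>vol\<^sub>\<alpha>) - (\<integral>x. f x \<partial>\<sigma>\<^sub>\<beta>))\<^sup>2 \<le> K1 * a + K2 * b"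
      unfolding a_def b_def using f assms by blast+
    \<comment> \<open>Both the boundary and the bulk energy control the boundary entropy and variance;
      \<open>s\<close> and \<open>t\<close> weigh the two bounds against each other.\<close>
    then have Ent_surf: "Ent \<sigma>\<^sub>\<beta> (\<lambda>x. (f x)\<^sup>2) \<le> s * (L_bd * a) + (1 - s) * (?L\<^sub>2 * b)"
      and Var_surf: "Var \<sigma>\<^sub>\<beta> f \<le> t * (K_bd * a) + (1 - t) * (?C\<^sub>2 * b)"
      using s t surf by (auto intro!: convex_combination_le)
    have "Ent (bulk_surface \<alpha> vol \<beta> \<sigma>) (\<lambda>x. (f x)\<^sup>2)
        \<le> A * Ent vol\<^sub>\<alpha> (\<lambda>x. (f x)\<^sup>2) + B * Ent \<sigma>\<^sub>\<beta> (\<lambda>x. (f x)\<^sup>2)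
          + A * B * log_quot A B *
              (Var vol\<^sub>\<alpha> f + Var \<sigma>\<^sub>\<beta> f + ((\<integral>x. f x \<partial>vol\<^sub>\<alpha>) - (\<integral>x. f x \<partial>\<sigma>\<^sub>\<beta>))\<^sup>2)"
      by (rule Ent_mixture_le[OF \<open>0 < A\<close> \<open>0 < B\<close> \<open>A + B = 1\<close>])
         (use prob int in \<open>auto intro!: mix\<close>)
    also have "\<dots> \<le> A * (?L\<^sub>1 * a) + B * (s * (L_bd * a) + (1 - s) * (?L\<^sub>2 * b))
          + A * B * log_quot A B *
              (?C\<^sub>1 * a + (t * (K_bd * a) + (1 - t) * (?C\<^sub>2 * b)) + (K1 * a + K2 * b))"
      using \<open>0 < A\<close> \<open>0 < B\<close> log_quot_pos[OF \<open>0 < A\<close> \<open>0 < B\<close>]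
      by (intro add_mono mult_left_mono bulk Ent_surf Var_surf means) auto
    also have "\<dots> \<le> ?bound s t * (A * a + B * b)"
      by (rule energy_combination_le_max[OF \<open>0 < A\<close> \<open>0 < B\<close> a b])
    finally show ?thesis
      by (simp only: scale_vol scale_\<sigma> a_def b_def)
  qed
  show ?thesis
  proof (rule le_ereal_INF)
    show "{0..1} \<times> {0..1} \<noteq> ({} :: (real \<times> real) set)" by auto
    \<comment> \<open>The first entry of the maximum is affine in \<open>(s, t)\<close> and hence bounded below on the unit
      square, whatever the signs of \<open>L_bd\<close> and \<open>K_bd\<close>.\<close>
    have unit_ge: "- \<bar>x\<bar> \<le> s * x" if "0 \<le> s" "s \<le> 1" for s x :: real
      using mult_right_mono[OF that(2), of "\<bar>x\<bar>"] that(1) by (auto simp: abs_if split: if_splits intro: order.trans[OF _ mult_nonneg_nonneg])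
    show "bdd_below ((\<lambda>(s, t). ?bound s t) ` ({0..1} \<times> {0..1}))"
    proof (rule bdd_belowI2)
      fix x :: "real \<times> real" assume "x \<in> {0..1} \<times> {0..1}"
      then obtain s t where x: "x = (s, t)" "0 \<le> s" "s \<le> 1" "0 \<le> t" "t \<le> 1" by auto
      have "?L\<^sub>1 - \<bar>L_bd * (B / A)\<bar> + B * log_quot A B * (?C\<^sub>1 - \<bar>K_bd\<bar> + K1)
          \<le> ?L\<^sub>1 + s * (L_bd * (B / A)) + B * log_quot A B * (?C\<^sub>1 + t * K_bd + K1)"
        using unit_ge[of s "L_bd * (B / A)"] unit_ge[of t K_bd] x
          \<open>0 < B\<close> log_quot_pos[OF \<open>0 < A\<close> \<open>0 < B\<close>]
        by (intro add_mono mult_left_mono) auto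
      then show "?L\<^sub>1 - \<bar>L_bd * (B / A)\<bar> + B * log_quot A B * (?C\<^sub>1 - \<bar>K_bd\<bar> + K1)
          \<le> (case x of (s, t) \<Rightarrow> ?bound s t)"
        unfolding x by (simp add: le_max_iff_disj mult.assoc)
    qed
    fix x :: "real \<times> real" assume "x \<in> {0..1} \<times> {0..1}"
    then obtain s t where x: "x = (s, t)" "0 \<le> s" "s \<le> 1" "0 \<le> t" "t \<le> 1" by auto
    show "mixed_log_sobolev_const M \<alpha> vol \<beta> \<sigma> \<le> ereal (case x of (s, t) \<Rightarrow> ?bound s t)"
      unfolding mixed_log_sobolev_const_def x prod.case
      using key x by (intro INF_lower) blast
  qed
qed

end
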